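(* The rightward winning-position functor $\mathcal W_r:\mathbf{roMPG}\to\mathbb S_r$ is a traced symmetric monoidal functor; in particular $\mathcal W_r(\mathcal A;\mathcal B)=\mathcal W_r(\mathcal A);\mathcal W_r(\mathcal B)$, $\mathcal W_r(\mathcal A\oplus\mathcal B)=\mathcal W_r(\mathcal A)\oplus\mathcal W_r(\mathcal B)$ and $\mathcal W_r(\mathrm{tr}^l_{m,n}(\mathcal E))=\mathrm{tr}^l_{m,n}(\mathcal W_r(\mathcal E))$ for all roMPGs $\mathcal A,\mathcal B,\mathcal E$ of appropriate types.
   Context: Notation: $[k]=\{1,\dots,k\}$ ($[0]=\emptyset$); $X+Y$ disjoint union; composition is diagrammatic $;$. roMPGs. An roMPG $\mathcal A:m\to n$ is a tuple $(m,n,Q,E,\rho,w)$: $Q$ a finite set of positions, entrances $[m]$, exits $[n]$ (pairwise disjoint with $Q$), edges $E\subseteq([m]+Q)\times([n]+Q)$ with every entrance having exactly one successor and every exit at most one predecessor, roles $\rho:Q\to\{\exists,\forall\}$, weights $w:Q\to\mathbb R$. For $\mathcal A:m\to l$, $\mathcal B:l\to n$, $\mathcal A;\mathcal B:m\to n$ has positions $Q^{\mathcal A}+Q^{\mathcal B}$ with inherited roles/weights and edges: edges of $\mathcal A$ from $[m]+Q^{\mathcal A}$ to $Q^{\mathcal A}$; edges of $\mathcal B$ from $Q^{\mathcal B}$ to $[n]+Q^{\mathcal B}$; $(s,s')$ with $s\in[m]+Q^{\mathcal A}$, $s'\in[n]+Q^{\mathcal B}$ whenever some $i\in[l]$ has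 $(s,i)\in E^{\mathcal A}$ and $(i,s')\in E^{\mathcal B}$; nothing else. $\mathcal A\oplus\mathcal B:m+k\to n+l$ (for $\mathcal A:m\to n$, $\mathcal B:k\to l$) is the disjoint union with $\mathcal B$'s entrances/exits renamed $j\mapsto m+j$, $j\mapsto n+j$. For $\mathcal A:l+m\to l+n$, $\mathrm{tr}^l_{m,n}(\mathcal A):m\to n$ has the same positions, roles, weights, and $(s,s')\in([m]+Q)\times([n]+Q)$ is an edge iff there are $k\ge0$, $i_1,\dots,i_k\in[l]$ with $(\hat s,i_1),(i_1,i_2),\dots,(i_k,\hat s')\in E^{\mathcal A}$ (for $k=0$: $(\hat s,\hat s')\in E^{\mathcal A}$), where $i_j$ is an exit as target and an entrance as source, and $\hat s=l+s$ for entrances/exits, $\hat s=s$ for positions. $\mathrm{id}_m$ has no positions and edges $(i,i)$; $\sigma_{m,n}:m+n\to n+m$ has no positions and edges $(i,n+i)$, $(m+j,j)$. $\mathbf{roMPG}$: objects $\mathbb N$, arrows roMPGs up to isomorphism (bijection of positions preserving edges, roles, weights, identity on open ends), with $;$, $\oplus$, $\mathrm{tr}$, $\mathrm{id}$, $\sigma$. Plays. In $\mathcal A:m\to n$, a play from entrance $i$ is a sequence $(s_j)_{j\in J}$, $J=\{0,..,M\}$ or $\mathbb N$, with $s_0=i$, consecutive elements joined by edges, and $s_M$ without successor if $J$ is finite. An infinite play satisfies the MP condition if $\liminf_N\frac1N\sum_{j=1}^Nw(s_j)\ge0$. $T(X)=X+\mathbb R\times X+\{\exists^*,\forall^*\}$.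 The denotation $[\![\pi]\!]\in T([n])$: $s_1$ if $J=\{0,1\}$ and $s_1$ is an exit; $(\sum_{j=1}^{M-1}w(s_j),s_M)$ if $M\ge2$ and $s_M$ is an exit; $\exists^*$ if $J$ finite with $s_M$ a $\forall$-position, or $J$ infinite satisfying MP; $\forall^*$ if $J$ finite with $s_M$ an $\exists$-position, or $J$ infinite failing MP. An $\exists$-strategy is a partial function $\tau:\rho^{-1}(\exists)\rightharpoonup[n]+Q$ defined exactly on positions with a successor, with $(s,\tau(s))\in E$; similarly $\forall$-strategies; sets $\Sigma_\exists(\mathcal A),\Sigma_\forall(\mathcal A)$. The induced play $\pi^{\tau_\exists,\tau_\forall}_i$ is the unique play from $i$ following $\tau_\exists$, $\tau_\forall$. Semantic categories. $\mathbb S^{\mathbb P}_r$: objects $\mathbb N$; arrows $f:m\to n$ are functions $[m]\to T([n])$ such that if $f(i)=k\in[n]$ then $f(j)\ne k$ and $f(j)\ne(r,k)$ for all $j\ne i$, $r\in\mathbb R$. $(f;g)(i)=f(i)$ if $f(i)\in\{\exists^*,\forall^*\}$; $g(j)$ if $f(i)=j$; $g(j)$ if $f(i)=(r,j)$, $g(j)\in\{\exists^*,\forall^*\}$; $(r,k)$ if $f(i)=(r,j)$, $g(j)=k$; $(r+r',k)$ if $f(i)=(r,j)$, $g(j)=(r',k)$. $\mathrm{id}(i)=i$; $\sigma_{m,n}(i)=n+i$ ($i\le m$), $\sigma_{m,n}(m+j)=j$; $(f\oplus g)(i)=f(i)$ for $i\le m$ and $(f\oplus g)(m+i)$ is $g(i)$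 with its index $j$ (if any) shifted to $n+j$. Trace of $f:l+m\to l+n$ at $i\in[m]$: $v_0=l+i$; if $j=0$ or $v_j\in[l]$ then $v_{j+1}=f(v_j)$; if $v_j=(r,k)$, $k\in[l]$, then $v_{j+1}=f(k)$; otherwise the sequence stops at $v_j$. If finite $(v_0,..,v_K)$, with $S$ the sum of first components of all $v_j\in\mathbb R\times[l+n]$, $1\le j\le K$: result $v_K$ if $v_K\in\{\exists^*,\forall^*\}$; $k$ if $v_K=l+k$ and no earlier $v_j$ carries a weight; $(S,k)$ if $v_K=l+k$ and some earlier $v_j$ carries a weight; $(S,k)$ if $v_K=(r,l+k)$. If infinite, with $w'_1,w'_2,\dots$ the first components of the (infinitely many) entries in $\mathbb R\times[l]$: $\exists^*$ if $\liminf_N\frac1N\sum_{t\le N}w'_t\ge0$, else $\forall^*$. $\mathbb S_r$: objects $\mathbb N$; arrows $m\to n$ are finite sets of finite sets of arrows $m\to n$ of $\mathbb S^{\mathbb P}_r$; $F;G=\{\{f;g\mid f\in F',g\in G'\}\mid F'\in F,G'\in G\}$, $\oplus$ analogously, $\mathrm{tr}(F)=\{\{\mathrm{tr}(f)\mid f\in F'\}\mid F'\in F\}$, identities $\{\{\mathrm{id}\}\}$, symmetries $\{\{\sigma\}\}$. $\mathcal W_r$ is the identity on objects and $\mathcal W_r(\mathcal A)=\big\{\{(i\mapsto[\![\pi^{\tau_\exists,\tau_\forall}_i]\!])\mid\tau_\forall\in\Sigma_\forall(\mathcal A)\}\mid\tau_\exists\in\Sigma_\exists(\mathcal A)\big\}$.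 *)

theory Defs
  imports "HOL-Library.Extended_Real" "HOL-Library.Infinite_Set"
begin

datatype player = PE | PA  (* PE = \<exists> (Eve), PA = \<forall> (Adam) *)

text \<open>A node is an element of nat + 'q.  In a SOURCE position of an edge, Inl i
  denotes entrance i; in a TARGET position, Inl k denotes exit k; Inr q is a position.
  Entrances are {1..gsrc}, exits are {1..gtgt}.\<close>

record 'q rompg =
  gsrc :: nat
  gtgt :: nat
  gpos :: "'q set"
  gedg :: "((nat + 'q) \<times> (nat + 'q)) set"
  grole :: "'q \<Rightarrow> player"
  gwgt :: "'q \<Rightarrow> real"

definition rompg_wf :: "'q rompg \<Rightarrow> bool" where
  "rompg_wf A \<longleftrightarrow>
     finite (gpos A) \<and>
     gedg A \<subseteq> ({1..gsrc A} <+> gpos A) \<times> ({1..gtgt A} <+> gpos A) \<and>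
     (\<forall>i\<in>{1..gsrc A}. \<exists>!t. (Inl i, t) \<in> gedg A) \<and>
     (\<forall>k\<in>{1..gtgt A}. \<forall>s s'. (s, Inl k) \<in> gedg A \<and> (s', Inl k) \<in> gedg A \<longrightarrow> s = s')"

definition rcomp :: "'a rompg \<Rightarrow> 'b rompg \<Rightarrow> ('a + 'b) rompg" where
  "rcomp A B = \<lparr> gsrc = gsrc A, gtgt = gtgt B,
     gpos = gpos A <+> gpos B,
     gedg = {(map_sum id Inl s, Inr (Inl q)) | s q. (s, Inr q) \<in> gedg A}
          \<union> {(Inr (Inr q), map_sum id Inr t) | q t. (Inr q, t) \<in> gedg B}
          \<union> {(map_sum id Inl s, map_sum id Inr t) | s t.
                \<exists>i\<in>{1..gtgt A}. (s, Inl i) \<in> gedg A \<and> (Inl i, t) \<in> gedg B},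
     grole = case_sum (grole A) (grole B),
     gwgt = case_sum (gwgt A) (gwgt B) \<rparr>"

definition shift_node :: "nat \<Rightarrow> (nat + 'b) \<Rightarrow> (nat + ('a + 'b))" where
  "shift_node d x = (case x of Inl j \<Rightarrow> Inl (d + j) | Inr q \<Rightarrow> Inr (Inr q))"

definition rtensor :: "'a rompg \<Rightarrow> 'b rompg \<Rightarrow> ('a + 'b) rompg" where
  "rtensor A B = \<lparr> gsrc = gsrc A + gsrc B, gtgt = gtgt A + gtgt B,
     gpos = gpos A <+> gpos B,
     gedg = {(map_sum id Inl s, map_sum id Inl t) | s t. (s, t) \<in> gedg A}
          \<union> {(shift_node (gsrc A) s, shift_node (gtgt A) t) | s t. (s, t) \<in> gedg B},
     grole = case_sum (grole A) (grole B),
     gwgt = case_sum (gwgt A) (gwgt B) \<rparr>"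

definition hat_node :: "nat \<Rightarrow> (nat + 'q) \<Rightarrow> (nat + 'q)" where
  "hat_node l x = (case x of Inl j \<Rightarrow> Inl (l + j) | Inr q \<Rightarrow> Inr q)"

definition rtrace :: "nat \<Rightarrow> nat \<Rightarrow> nat \<Rightarrow> 'q rompg \<Rightarrow> 'q rompg" where
  "rtrace l m n E = \<lparr> gsrc = m, gtgt = n, gpos = gpos E,
     gedg = {(s, s'). s \<in> {1..m} <+> gpos E \<and> s' \<in> {1..n} <+> gpos E \<and>
              ((hat_node l s, hat_node l s') \<in> gedg E \<or>
               (\<exists>i j. i \<in> {1..l} \<and> j \<in> {1..l} \<and> (hat_node l s, Inl i) \<in> gedg E \<and>
                 (i, j) \<in> {(a, b). a \<in> {1..l} \<and> b \<in> {1..l} \<and> (Inl a, Inl b) \<in> gedg E}\<^sup>* \<and>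
                 (Inl j, hat_node l s') \<in> gedg E))},
     grole = grole E, gwgt = gwgt E \<rparr>"

definition rid :: "nat \<Rightarrow> 'q rompg" where
  "rid m = \<lparr> gsrc = m, gtgt = m, gpos = {}, gedg = {(Inl i, Inl i) | i. i \<in> {1..m}},
     grole = (\<lambda>_. PE), gwgt = (\<lambda>_. 0) \<rparr>"

definition rsym :: "nat \<Rightarrow> nat \<Rightarrow> 'q rompg" where
  "rsym m n = \<lparr> gsrc = m + n, gtgt = n + m, gpos = {},
     gedg = {(Inl i, Inl (n + i)) | i. i \<in> {1..m}} \<union> {(Inl (m + j), Inl j) | j. j \<in> {1..n}},
     grole = (\<lambda>_. PE), gwgt = (\<lambda>_. 0) \<rparr>"

text \<open>T(X) = X + R \<times> X + {\<exists>*, \<forall>*}\<close>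
datatype tval = Ret nat | WRet real nat | EW | AW

text \<open>Arrows m \<rightarrow> n of S^P are represented by functions nat \<Rightarrow> tval that are
  undefined outside {1..m}.\<close>
definition restr :: "nat \<Rightarrow> (nat \<Rightarrow> 'x) \<Rightarrow> nat \<Rightarrow> 'x" where
  "restr m f = (\<lambda>i. if i \<in> {1..m} then f i else undefined)"

definition sp_arrow :: "nat \<Rightarrow> nat \<Rightarrow> (nat \<Rightarrow> tval) \<Rightarrow> bool" where
  "sp_arrow m n f \<longleftrightarrow> f = restr m f \<and>
     (\<forall>i\<in>{1..m}. \<forall>k r. (f i = Ret k \<or> f i = WRet r k) \<longrightarrow> k \<in> {1..n}) \<and>
     (\<forall>i\<in>{1..m}. \<forall>j\<in>{1..m}. \<forall>k. i \<noteq> j \<and> f i = Ret k \<longrightarrow>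
         f j \<noteq> Ret k \<and> (\<forall>r. f j \<noteq> WRet r k))"

definition sr_arrow :: "nat \<Rightarrow> nat \<Rightarrow> (nat \<Rightarrow> tval) set set \<Rightarrow> bool" where
  "sr_arrow m n F \<longleftrightarrow> finite F \<and> (\<forall>F'\<in>F. finite F' \<and> (\<forall>f\<in>F'. sp_arrow m n f))"

definition spcomp :: "nat \<Rightarrow> (nat \<Rightarrow> tval) \<Rightarrow> (nat \<Rightarrow> tval) \<Rightarrow> nat \<Rightarrow> tval" where
  "spcomp m f g = restr m (\<lambda>i. case f i of
       EW \<Rightarrow> EW | AW \<Rightarrow> AW
     | Ret j \<Rightarrow> g j
     | WRet r j \<Rightarrow> (case g j of EW \<Rightarrow> EW | AW \<Rightarrow> AW | Ret k \<Rightarrow> WRet r k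
                     | WRet r' k \<Rightarrow> WRet (r + r') k))"

definition spid :: "nat \<Rightarrow> nat \<Rightarrow> tval" where
  "spid m = restr m Ret"

definition spsym :: "nat \<Rightarrow> nat \<Rightarrow> nat \<Rightarrow> tval" where
  "spsym m n = restr (m + n) (\<lambda>i. if i \<le> m then Ret (n + i) else Ret (i - m))"

fun tshift :: "nat \<Rightarrow> tval \<Rightarrow> tval" where
  "tshift d (Ret j) = Ret (d + j)"
| "tshift d (WRet r j) = WRet r (d + j)"
| "tshift d EW = EW"
| "tshift d AW = AW"

text \<open>f : m \<rightarrow> n, g : k \<rightarrow> l2\<close>
definition sptensor :: "nat \<Rightarrow> nat \<Rightarrow> nat \<Rightarrow> (nat \<Rightarrow> tval) \<Rightarrow> (nat \<Rightarrow> tval) \<Rightarrow> nat \<Rightarrow> tval" where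
  "sptensor m n k f g = restr (m + k) (\<lambda>i. if i \<le> m then f i else tshift n (g (i - m)))"

fun tnext :: "nat \<Rightarrow> (nat \<Rightarrow> tval) \<Rightarrow> tval \<Rightarrow> tval option" where
  "tnext l f (Ret k) = (if k \<in> {1..l} then Some (f k) else None)"
| "tnext l f (WRet r k) = (if k \<in> {1..l} then Some (f k) else None)"
| "tnext l f EW = None"
| "tnext l f AW = None"

text \<open>vseq l f i j = v_{j+1} of the trace sequence started at v_0 = l + i.\<close>
primrec vseq :: "nat \<Rightarrow> (nat \<Rightarrow> tval) \<Rightarrow> nat \<Rightarrow> nat \<Rightarrow> tval option" where
  "vseq l f i 0 = Some (f (l + i))"
| "vseq l f i (Suc j) = Option.bind (vseq l f i j) (tnext l f)"

fun tweight :: "tval \<Rightarrow> real" where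
  "tweight (WRet r k) = r"
| "tweight _ = 0"

fun is_weighted :: "tval \<Rightarrow> bool" where
  "is_weighted (WRet r k) = True"
| "is_weighted _ = False"

definition trace_val :: "nat \<Rightarrow> (nat \<Rightarrow> tval) \<Rightarrow> nat \<Rightarrow> tval" where
  "trace_val l f i =
    (let v = vseq l f i in
     if \<exists>j. v j = None then
       (let K = (LEAST j. v j = None);
            S = (\<Sum>j<K. tweight (the (v j)));
            hasw = (\<exists>j<K. is_weighted (the (v j)))
        in case the (v (K - 1)) of
             EW \<Rightarrow> EW | AW \<Rightarrow> AW
           | Ret k \<Rightarrow> (if hasw then WRet S (k - l) else Ret (k - l))
           | WRet r k \<Rightarrow> WRet S (k - l))
     else
       (let I = {j. is_weighted (the (v j))};
            w' = (\<lambda>t. tweight (the (v (Infinite_Set.enumerate I t))))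
        in if liminf (\<lambda>N. ereal ((\<Sum>t<N. w' t) / real N)) \<ge> 0 then EW else AW))"

definition sptrace :: "nat \<Rightarrow> nat \<Rightarrow> (nat \<Rightarrow> tval) \<Rightarrow> nat \<Rightarrow> tval" where
  "sptrace l m f = restr m (trace_val l f)"

definition Scomp :: "nat \<Rightarrow> (nat \<Rightarrow> tval) set set \<Rightarrow> (nat \<Rightarrow> tval) set set \<Rightarrow> (nat \<Rightarrow> tval) set set" where
  "Scomp m F G = {{spcomp m f g | f g. f \<in> F' \<and> g \<in> G'} | F' G'. F' \<in> F \<and> G' \<in> G}"

definition Stensor :: "nat \<Rightarrow> nat \<Rightarrow> nat \<Rightarrow> (nat \<Rightarrow> tval) set set \<Rightarrow> (nat \<Rightarrow> tval) set set \<Rightarrow> (nat \<Rightarrow> tval) set set" where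
  "Stensor m n k F G = {{sptensor m n k f g | f g. f \<in> F' \<and> g \<in> G'} | F' G'. F' \<in> F \<and> G' \<in> G}"

definition Strace :: "nat \<Rightarrow> nat \<Rightarrow> (nat \<Rightarrow> tval) set set \<Rightarrow> (nat \<Rightarrow> tval) set set" where
  "Strace l m F = {{sptrace l m f | f. f \<in> F'} | F'. F' \<in> F}"

definition Sid :: "nat \<Rightarrow> (nat \<Rightarrow> tval) set set" where
  "Sid m = {{spid m}}"

definition Ssym :: "nat \<Rightarrow> nat \<Rightarrow> (nat \<Rightarrow> tval) set set" where
  "Ssym m n = {{spsym m n}}"

definition strategies :: "player \<Rightarrow> 'q rompg \<Rightarrow> ('q \<Rightarrow> (nat + 'q) option) set" where
  "strategies P A = {\<tau>. \<forall>q.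
      (\<tau> q \<noteq> None \<longleftrightarrow> q \<in> gpos A \<and> grole A q = P \<and> (\<exists>t. (Inr q, t) \<in> gedg A)) \<and>
      (\<forall>t. \<tau> q = Some t \<longrightarrow> (Inr q, t) \<in> gedg A)}"

fun next_node :: "'q rompg \<Rightarrow> ('q \<Rightarrow> (nat + 'q) option) \<Rightarrow> ('q \<Rightarrow> (nat + 'q) option)
                   \<Rightarrow> (nat + 'q) \<Rightarrow> (nat + 'q) option" where
  "next_node A te ta (Inl k) = None"
| "next_node A te ta (Inr q) = (if grole A q = PE then te q else ta q)"

text \<open>play A te ta i j = s_{j+1}, the (j+1)-th element of the induced play from
  entrance i (s_0 = i); None once the play has ended.\<close>
primrec play :: "'q rompg \<Rightarrow> ('q \<Rightarrow> (nat + 'q) option) \<Rightarrow> ('q \<Rightarrow> (nat + 'q) option)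
                  \<Rightarrow> nat \<Rightarrow> nat \<Rightarrow> (nat + 'q) option" where
  "play A te ta i 0 = Some (THE t. (Inl i, t) \<in> gedg A)"
| "play A te ta i (Suc j) = Option.bind (play A te ta i j) (next_node A te ta)"

definition node_wgt :: "'q rompg \<Rightarrow> (nat + 'q) \<Rightarrow> real" where
  "node_wgt A x = (case x of Inl _ \<Rightarrow> 0 | Inr q \<Rightarrow> gwgt A q)"

definition play_den :: "'q rompg \<Rightarrow> ('q \<Rightarrow> (nat + 'q) option) \<Rightarrow> ('q \<Rightarrow> (nat + 'q) option)
                         \<Rightarrow> nat \<Rightarrow> tval" where
  "play_den A te ta i =
    (let s = play A te ta i in
     if \<exists>j. s j = None then
       (let M = (LEAST j. s j = None) in
        case the (s (M - 1)) of
          Inl k \<Rightarrow> (if M = 1 then Ret k else WRet (\<Sum>j<M - 1. node_wgt A (the (s j))) k)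
        | Inr q \<Rightarrow> (if grole A q = PA then EW else AW))
     else
       (if liminf (\<lambda>N. ereal ((\<Sum>j<N. node_wgt A (the (s j))) / real N)) \<ge> 0
        then EW else AW))"

definition W_r :: "'q rompg \<Rightarrow> (nat \<Rightarrow> tval) set set" where
  "W_r A = {{restr (gsrc A) (play_den A te ta) | ta. ta \<in> strategies PA A}
             | te. te \<in> strategies PE A}"

end

theory Submission
  imports Defs
begin

text \<open>Composition, tensor and trace all embed the positions of a game into the result and reroute its
  exits. Along such a map the positional strategies correspond, and the play started at the image of
  a node is the original play, continued from the image of the exit that it reaches. Composition and
  tensor follow at once.

  For the trace, an exit reached from outside the loop is sent to the end of the chain of loop edges
  that starts there; the chain is finite because every exit has at most one predecessor. A play of
  the trace that passes through the loop infinitely often is a concatenation of segments between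
  consecutive visits to the loop. The segments have bounded length and the empty ones carry no
  weight, so the averages over positions and over nonempty segments have limits inferior of the same
  sign: both are nonnegative iff the partial sums are bounded below by
  \<open>- \<epsilon> N - C\<close> for every \<open>\<epsilon> > 0\<close>.\<close>

section \<open>Mean payoff\<close>

definition mp :: "(nat \<Rightarrow> real) \<Rightarrow> bool" where
  "mp w \<longleftrightarrow> liminf (\<lambda>N. ereal ((\<Sum>j<N. w j) / real N)) \<ge> 0"

text \<open>Linear lower bounds on partial sums are easier to reindex than a limit inferior:
  \<open>C\<close> absorbs any finite initial part, and letting \<open>\<epsilon>\<close> shrink
  recovers the condition on averages.\<close>

lemma mp_iff: "mp w \<longleftrightarrow> (\<forall>\<epsilon>>0. \<exists>C. \<forall>N. (\<Sum>j<N. w j) \<ge> - \<epsilon> * real N - C)"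
proof
  assume "mp w"
  then have ev: "\<forall>y<0. \<forall>\<^sub>F N in sequentially. y < ereal ((\<Sum>j<N. w j) / real N)"
    by (simp add: mp_def le_Liminf_iff)
  show "\<forall>\<epsilon>>0. \<exists>C. \<forall>N. (\<Sum>j<N. w j) \<ge> - \<epsilon> * real N - C"
  proof (intro allI impI)
    fix \<epsilon> :: real assume "\<epsilon> > 0"
    then have "ereal (-\<epsilon>) < 0" by simp
    with ev obtain N0 where N0: "\<And>N. N \<ge> N0 \<Longrightarrow> - \<epsilon> < (\<Sum>j<N. w j) / real N"
      by (fastforce simp: eventually_sequentially)
    \<comment> \<open>Dominates each of the finitely many partial sums up to \<open>N0\<close>,
      about which the eventual bound says nothing.\<close>
    define C where "C = (\<Sum>N\<le>N0. \<bar>\<Sum>j<N. w j\<bar>)"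
    have C0: "C \<ge> 0" by (simp add: C_def sum_nonneg)
    have "(\<Sum>j<N. w j) \<ge> - \<epsilon> * real N - C" for N
    proof (cases "N > N0")
      case True
      then have "- \<epsilon> * real N < (\<Sum>j<N. w j)"
        using N0[of N] by (simp add: field_simps)
      with C0 show ?thesis by linarith
    next
      case False
      then have "\<bar>\<Sum>j<N. w j\<bar> \<le> C"
        unfolding C_def by (intro member_le_sum[of N "{..N0}" "\<lambda>N. \<bar>\<Sum>j<N. w j\<bar>"]) auto
      moreover have "\<epsilon> * real N \<ge> 0" using \<open>\<epsilon> > 0\<close> by simp
      ultimately show ?thesis by linarith
    qed
    then show "\<exists>C. \<forall>N. (\<Sum>j<N. w j) \<ge> - \<epsilon> * real N - C" by blast
  qed
next
  assume bnd: "\<forall>\<epsilon>>0. \<exists>C. \<forall>N. (\<Sum>j<N. w j) \<ge> - \<epsilon> * real N - C"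
  have "\<forall>\<^sub>F N in sequentially. y < ereal ((\<Sum>j<N. w j) / real N)" if "y < 0" for y
  proof -
    obtain z where z: "y < ereal z" "ereal z < 0"
      using \<open>y < 0\<close> ereal_dense2 by blast
    then have "z < 0" by simp
    \<comment> \<open>Half of the slack: once \<open>N > \<bar>C\<bar> / \<epsilon>\<close>, the two
      losses \<open>\<epsilon> * N\<close> and \<open>C\<close> add up to less than
      \<open>- z * N\<close>.\<close>
    define \<epsilon> where "\<epsilon> = - z / 2"
    have "\<epsilon> > 0" using \<open>z < 0\<close> by (simp add: \<epsilon>_def)
    with bnd obtain C where C: "\<And>N. (\<Sum>j<N. w j) \<ge> - \<epsilon> * real N - C" by blast
    obtain N0 :: nat where N0: "real N0 > \<bar>C\<bar> / \<epsilon>"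
      using reals_Archimedean2 by blast
    have "y < ereal ((\<Sum>j<N. w j) / real N)" if "N \<ge> N0" for N
    proof -
      have gt: "real N > \<bar>C\<bar> / \<epsilon>" using N0 that by linarith
      then have "real N > 0" using \<open>\<epsilon> > 0\<close> by (smt (verit) divide_nonneg_pos)
      moreover have "C < \<epsilon> * real N" using gt \<open>\<epsilon> > 0\<close> by (simp add: field_simps)
      ultimately have "z < (\<Sum>j<N. w j) / real N"
        using C[of N] by (simp add: field_simps \<epsilon>_def)
      with z show ?thesis by (meson less_ereal.simps(1) less_trans)
    qed
    then show ?thesis by (auto simp: eventually_sequentially)
  qed
  then show "mp w" by (simp add: mp_def le_Liminf_iff)
qed

text \<open>One term more or less changes partial sums by a bounded amount, which the constant in
  \<open>mp_iff\<close> absorbs.\<close>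

lemma mp_shift: "mp (\<lambda>j. w (Suc j)) \<longleftrightarrow> mp w"
proof
  assume a: "mp (\<lambda>j. w (Suc j))"
  show "mp w"
    unfolding mp_iff
  proof (intro allI impI)
    fix \<epsilon> :: real assume "\<epsilon> > 0"
    with a obtain C where C: "\<And>N. (\<Sum>j<N. w (Suc j)) \<ge> - \<epsilon> * real N - C"
      by (auto simp: mp_iff)
    have "(\<Sum>j<N. w j) \<ge> - \<epsilon> * real N - (\<bar>C\<bar> + \<bar>w 0\<bar>)" for N
    proof (cases N)
      case (Suc N')
      then show ?thesis using C[of N'] \<open>\<epsilon> > 0\<close>
        by (simp add: sum.lessThan_Suc_shift algebra_simps del: sum.lessThan_Suc)
    qed simp
    then show "\<exists>C. \<forall>N. (\<Sum>j<N. w j) \<ge> - \<epsilon> * real N - C" by blast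
  qed
next
  assume a: "mp w"
  show "mp (\<lambda>j. w (Suc j))"
    unfolding mp_iff
  proof (intro allI impI)
    fix \<epsilon> :: real assume "\<epsilon> > 0"
    with a obtain C where C: "\<And>N. (\<Sum>j<N. w j) \<ge> - \<epsilon> * real N - C"
      by (auto simp: mp_iff)
    have "(\<Sum>j<N. w (Suc j)) \<ge> - \<epsilon> * real N - (C + \<epsilon> + w 0)" for N
      using C[of "Suc N"]
      by (simp add: sum.lessThan_Suc_shift algebra_simps del: sum.lessThan_Suc)
    then show "\<exists>C. \<forall>N. (\<Sum>j<N. w (Suc j)) \<ge> - \<epsilon> * real N - C" by blast
  qed
qed

section \<open>Values of plays\<close>

text \<open>Common form of plays and of the trace sequences in the semantic category: both iterate a
  partial step function, and \<open>None\<close> marks the end.\<close>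

primrec run :: "('x \<Rightarrow> 'x option) \<Rightarrow> 'x \<Rightarrow> nat \<Rightarrow> 'x option" where
  "run f x 0 = Some x"
| "run f x (Suc j) = Option.bind (run f x j) f"

lemma run_add: "run f x (i + j) = Option.bind (run f x i) (\<lambda>y. run f y j)"
proof (induction j)
  case 0
  show ?case by (cases "run f x i") auto
next
  case (Suc j)
  then show ?case by (cases "run f x i") auto
qed

lemma run_Suc_shift: "run f x (Suc j) = Option.bind (f x) (\<lambda>y. run f y j)"
  using run_add[of f x 1 j] by simp

lemma run_None_mono: "run f x i = None \<Longrightarrow> i \<le> j \<Longrightarrow> run f x j = None"
  using run_add[of f x i "j - i"] by simp

text \<open>Backward induction along a terminating iteration. Termination from \<open>y\<close> is
  handed on because the unfolding law for traces requires it.\<close>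

lemma run_finite_induct [consumes 1, case_names stop step]:
  assumes "run f x j = None"
    and stop: "\<And>x. f x = None \<Longrightarrow> P x"
    and step: "\<And>x y j. f x = Some y \<Longrightarrow> run f y j = None \<Longrightarrow> P y \<Longrightarrow> P x"
  shows "P x"
  using assms(1)
proof (induction j arbitrary: x)
  case (Suc j)
  show ?case
  proof (cases "f x")
    case None
    then show ?thesis by (rule stop)
  next
    case (Some y)
    then have "run f y j = None"
      using Suc.prems by (simp only: run_Suc_shift) simp
    then show ?thesis using Some Suc.IH step by blast
  qed
qed simp

lemma Least_run_None:
  assumes "f x = Some y" "run f y j = None"
  shows "(LEAST j. run f x j = None) = Suc (LEAST j. run f y j = None)"
proof -
  have *: "run f x (Suc i) = run f y i" for i
    by (simp only: run_Suc_shift assms(1)) simp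
  have "(LEAST j. run f x j = None) = Suc (LEAST j. run f x (Suc j) = None)"
  proof (rule Least_Suc)
    show "run f x (Suc j) = None" using assms(2) by (simp only: *)
  qed simp
  then show ?thesis by (simp only: *)
qed

lemma Least_run_None_pos:
  assumes "run f x j = None"
  obtains i where "(LEAST j. run f x j = None) = Suc i" "run f x i \<noteq> None"
proof (cases "LEAST j. run f x j = None")
  case 0
  then show ?thesis using LeastI[of "\<lambda>j. run f x j = None", OF assms] by simp
next
  case (Suc i)
  then show ?thesis using that not_less_Least[of i "\<lambda>j. run f x j = None"] by auto
qed

section \<open>Denotations from an arbitrary node\<close>

definition esucc :: "'q rompg \<Rightarrow> nat \<Rightarrow> nat + 'q" where
  "esucc A i = (THE t. (Inl i, t) \<in> gedg A)"

text \<open>Starting at any target node, in the place of s_1, gives a recursion along edges that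
  entrances alone do not allow.\<close>

definition den :: "'q rompg \<Rightarrow> ('q \<Rightarrow> (nat + 'q) option) \<Rightarrow> ('q \<Rightarrow> (nat + 'q) option)
    \<Rightarrow> nat + 'q \<Rightarrow> tval" where
  "den A te ta x =
    (let s = run (next_node A te ta) x in
     if \<exists>j. s j = None then
       (let M = (LEAST j. s j = None) in
        case the (s (M - 1)) of
          Inl k \<Rightarrow> (if M = 1 then Ret k else WRet (\<Sum>j<M - 1. node_wgt A (the (s j))) k)
        | Inr q \<Rightarrow> (if grole A q = PA then EW else AW))
     else if mp (\<lambda>j. node_wgt A (the (s j))) then EW else AW)"

lemma play_eq_run: "play A te ta i = run (next_node A te ta) (esucc A i)"
proof
  show "play A te ta i j = run (next_node A te ta) (esucc A i) j" for j
    by (induction j) (auto simp: esucc_def)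
qed

lemma play_den_eq_den: "play_den A te ta i = den A te ta (esucc A i)"
  unfolding play_den_def den_def play_eq_run mp_def by meson

text \<open>Weight \<open>0\<close> is not neutral: \<open>Ret k\<close> becomes
  \<open>WRet 0 k\<close>, since having met a position is recorded even when it weighs
  nothing.\<close>

fun addw :: "real \<Rightarrow> tval \<Rightarrow> tval" where
  "addw w (Ret k) = WRet w k"
| "addw w (WRet r k) = WRet (w + r) k"
| "addw w EW = EW"
| "addw w AW = AW"

text \<open>Kleisli extension of the monad T: the reals with a fresh unit are the accumulated
  weights, and \<open>EW\<close>, \<open>AW\<close> behave like exceptions.\<close>

fun tbind :: "tval \<Rightarrow> (nat \<Rightarrow> tval) \<Rightarrow> tval" where
  "tbind (Ret k) g = g k"
| "tbind (WRet r k) g = addw r (g k)"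
| "tbind EW g = EW"
| "tbind AW g = AW"

lemma addw_add: "addw w (addw r v) = addw (w + r) v"
  by (cases v) auto

lemma addw_tbind: "addw w (tbind v g) = tbind (addw w v) g"
  by (cases v) (auto simp: addw_add)

lemma spcomp_eq_tbind: "spcomp m f g = restr m (\<lambda>i. tbind (f i) g)"
  unfolding spcomp_def restr_def
  by (intro ext) (auto split: tval.splits)

lemma node_wgt_simps [simp]: "node_wgt A (Inl k) = 0" "node_wgt A (Inr q) = gwgt A q"
  by (simp_all add: node_wgt_def)

lemma den_stop:
  assumes "next_node A te ta x = None"
  shows "den A te ta x = (case x of Inl k \<Rightarrow> Ret k | Inr q \<Rightarrow> if grole A q = PA then EW else AW)"
proof -
  have "(LEAST j. run (next_node A te ta) x j = None) = 1"
    by (rule Least_equality) (use assms in \<open>auto simp: Suc_le_eq intro: gr0I\<close>)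
  moreover have "\<exists>j. run (next_node A te ta) x j = None"
    using assms by (intro exI[of _ 1]) simp
  ultimately show ?thesis
    by (simp add: den_def Let_def split: sum.splits)
qed

lemma den_Inl [simp]: "den A te ta (Inl k) = Ret k"
  by (simp add: den_stop)

lemma den_infinite:
  assumes "\<And>j. run (next_node A te ta) x j \<noteq> None"
  shows "den A te ta x
    = (if mp (\<lambda>j. node_wgt A (the (run (next_node A te ta) x j))) then EW else AW)"
  using assms unfolding den_def Let_def by (meson not_None_eq)

text \<open>Finite plays become one step longer. For infinite ones \<open>addw\<close> changes
  nothing, and \<open>mp_shift\<close> removes the first weight.\<close>

lemma den_step:
  assumes nx: "next_node A te ta (Inr q) = Some y"
  shows "den A te ta (Inr q) = addw (gwgt A q) (den A te ta y)"
proof -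
  let ?f = "next_node A te ta"
  have sh: "run ?f (Inr q) (Suc i) = run ?f y i" for i
    by (simp only: run_Suc_shift nx) simp
  show ?thesis
  proof (cases "\<exists>j. run ?f y j = None")
    case True
    then obtain j where j: "run ?f y j = None" ..
    obtain i where i: "(LEAST j. run ?f y j = None) = Suc i" "run ?f y i \<noteq> None"
      using Least_run_None_pos[OF j] .
    have L: "(LEAST j. run ?f (Inr q) j = None) = Suc (Suc i)"
      using Least_run_None[OF nx j] i by simp
    have ex: "\<exists>j. run ?f (Inr q) j = None" using j sh by metis
    have s: "(\<Sum>j<Suc i. node_wgt A (the (run ?f (Inr q) j)))
        = gwgt A q + (\<Sum>j<i. node_wgt A (the (run ?f y j)))"
      by (simp add: sum.lessThan_Suc_shift sh del: sum.lessThan_Suc run.simps(2))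
    show ?thesis
      using True ex unfolding den_def Let_def L i(1) diff_Suc_1 s sh
      by (auto split: sum.splits)
  next
    case False
    then have "\<And>j. run ?f y j \<noteq> None" by auto
    moreover have "run ?f (Inr q) j \<noteq> None" for j
      using False sh by (cases j) (auto simp del: run.simps(2))
    ultimately show ?thesis
      using mp_shift[of "\<lambda>j. node_wgt A (the (run ?f (Inr q) j))"]
      by (simp add: den_infinite sh del: run.simps(2))
  qed
qed

text \<open>As long as the play in \<open>A\<close> is at positions, \<open>h\<close> carries it to
  the play in \<open>G\<close>; once it reaches an exit, \<open>G\<close> goes on from the image of
  that exit. An infinite play keeps its weights, and \<open>tbind\<close> then ignores the
  continuation.\<close>

lemma den_bind:
  assumes h: "\<And>q. h (Inr q) = Inr (e q)"
    and nx: "\<And>q. next_node G te' ta' (Inr (e q)) = map_option h (next_node A te ta (Inr q))"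
    and role: "\<And>q. grole G (e q) = grole A q"
    and wgt: "\<And>q. gwgt G (e q) = gwgt A q"
  shows "den G te' ta' (h x) = tbind (den A te ta x) (\<lambda>k. den G te' ta' (h (Inl k)))"
proof (cases "\<exists>j. run (next_node A te ta) x j = None")
  case True
  then obtain j where "run (next_node A te ta) x j = None" ..
  then show ?thesis
  proof (induction rule: run_finite_induct)
    case (stop x)
    show ?case
    proof (cases x)
      case (Inr q)
      then have "next_node G te' ta' (h x) = None" using stop h nx by simp
      then show ?thesis using stop Inr by (simp add: den_stop h role)
    qed simp
  next
    case (step x y j)
    then obtain q where x: "x = Inr q" by (cases x) auto
    then have "next_node G te' ta' (Inr (e q)) = Some (h y)" using step nx by simp
    then show ?case
      using step x by (simp add: h den_step wgt addw_tbind del: next_node.simps)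
  qed
next
  case False
  let ?r = "run (next_node A te ta) x" and ?r' = "run (next_node G te' ta') (h x)"
  \<comment> \<open>Exits have no next node, so an infinite play never visits one and the two runs
    match step by step.\<close>
  have pos: "\<exists>q. ?r j = Some (Inr q)" for j
  proof -
    from False obtain y where y: "?r j = Some y" by (meson not_None_eq)
    with False have "next_node A te ta y \<noteq> None"
      by (metis run.simps(2) Option.bind.bind_lunit)
    with y show ?thesis by (cases y) auto
  qed
  have r': "?r' j = map_option h (?r j)" for j
  proof (induction j)
    case (Suc j)
    obtain q where "?r j = Some (Inr q)" using pos by blast
    then show ?case using Suc nx h by (simp del: next_node.simps)
  qed simp
  have "node_wgt G (the (?r' j)) = node_wgt A (the (?r j))" for j
    using pos[of j] r'[of j] by (auto simp: h wgt)
  moreover have "?r' j \<noteq> None" for j using False r' by simp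
  moreover have "?r j \<noteq> None" for j using False by simp
  ultimately have "den G te' ta' (h x) = den A te ta x"
    by (simp add: den_infinite)
  moreover have "den A te ta x \<in> {EW, AW}"
    using False by (auto simp: den_infinite)
  ultimately show ?thesis by auto
qed


section \<open>Exits reached by plays, and well-definedness of the functor on arrows\<close>

lemma den_Ret_imp: "den A te ta x = Ret k \<Longrightarrow> x = Inl k"
proof (cases x)
  case (Inr q)
  assume "den A te ta x = Ret k"
  moreover have "addw w v \<noteq> Ret k" for w v by (cases v) auto
  ultimately show ?thesis
    using den_stop[of A te ta x] den_step[of A te ta q] Inr
    by (cases "next_node A te ta (Inr q)") (auto simp del: next_node.simps split: if_splits)
qed simp

lemma next_node_edge:
  assumes "te \<in> strategies PE A" "ta \<in> strategies PA A" "next_node A te ta x = Some y"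
  obtains q where "x = Inr q" "q \<in> gpos A" "(Inr q, y) \<in> gedg A"
proof (cases x)
  case (Inr q)
  then show ?thesis
    using assms that[of q] by (cases "grole A q") (force simp: strategies_def)+
qed (use assms in auto)

text \<open>The last move before a weighted exit leaves a position. With \<open>den_Ret_imp\<close>,
  this lets uniqueness of predecessors separate direct from weighted arrivals.\<close>

lemma den_WRet_edge:
  assumes st: "te \<in> strategies PE A" "ta \<in> strategies PA A"
    and "den A te ta x = WRet r k"
  shows "\<exists>q. (Inr q, Inl k) \<in> gedg A"
proof -
  from assms(3) obtain j where "run (next_node A te ta) x j = None"
    using den_infinite[of A te ta x] by (metis tval.distinct(7,9))
  then show ?thesis
    using assms(3)
  proof (induction arbitrary: r rule: run_finite_induct)
    case (stop x)
    then show ?case by (auto simp: den_stop split: sum.splits if_splits)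
  next
    case (step x y j)
    obtain q where q: "x = Inr q" "(Inr q, y) \<in> gedg A"
      using next_node_edge[OF st step(1)] by blast
    then have *: "addw (gwgt A q) (den A te ta y) = WRet r k"
      using step den_step[of A te ta q y] by simp
    then show ?case
    proof (cases "den A te ta y")
      case (Ret k')
      then show ?thesis using * den_Ret_imp[OF Ret] q by auto
    qed (use step.IH in auto)
  qed
qed

lemma esucc_edge:
  assumes "rompg_wf A" "i \<in> {1..gsrc A}"
  shows "(Inl i, t) \<in> gedg A \<longleftrightarrow> t = esucc A i"
  using assms theI'[of "\<lambda>t. (Inl i, t) \<in> gedg A"]
  unfolding rompg_wf_def esucc_def by blast

lemma gedg_nodes:
  assumes "rompg_wf A"
  shows "(Inl i, t) \<in> gedg A \<Longrightarrow> i \<in> {1..gsrc A}"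
    and "(Inr q, t) \<in> gedg A \<Longrightarrow> q \<in> gpos A"
    and "(s, Inl k) \<in> gedg A \<Longrightarrow> k \<in> {1..gtgt A}"
    and "(s, Inr q') \<in> gedg A \<Longrightarrow> q' \<in> gpos A"
  using assms unfolding rompg_wf_def by fastforce+

lemma exit_pred_unique:
  assumes "rompg_wf A" "(s, Inl k) \<in> gedg A" "(s', Inl k) \<in> gedg A"
  shows "s = s'"
  using assms gedg_nodes(3)[OF assms(1,2)] unfolding rompg_wf_def by blast

lemma play_den_exit:
  assumes "rompg_wf A" "te \<in> strategies PE A" "ta \<in> strategies PA A" "i \<in> {1..gsrc A}"
  shows "play_den A te ta i = Ret k \<Longrightarrow> (Inl i, Inl k) \<in> gedg A"
    and "play_den A te ta i = WRet r k \<Longrightarrow> \<exists>q. (Inr q, Inl k) \<in> gedg A"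
  using den_Ret_imp[of A te ta "esucc A i" k] esucc_edge[OF assms(1,4)]
    den_WRet_edge[OF assms(2,3)]
  by (auto simp: play_den_eq_den)

lemma play_den_exit_range:
  assumes "rompg_wf A" "te \<in> strategies PE A" "ta \<in> strategies PA A" "i \<in> {1..gsrc A}"
    and "play_den A te ta i = Ret k \<or> play_den A te ta i = WRet r k"
  shows "k \<in> {1..gtgt A}"
  using play_den_exit[OF assms(1-4)] gedg_nodes(3)[OF assms(1)] assms(5) by blast

lemma sp_arrow_play_den:
  assumes wf: "rompg_wf A" and st: "te \<in> strategies PE A" "ta \<in> strategies PA A"
  shows "sp_arrow (gsrc A) (gtgt A) (restr (gsrc A) (play_den A te ta))"
proof -
  let ?f = "restr (gsrc A) (play_den A te ta)"
  have f: "?f i = play_den A te ta i" if "i \<in> {1..gsrc A}" for i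
    using that by (simp add: restr_def)
  show ?thesis
    unfolding sp_arrow_def
  proof (intro conjI ballI allI impI)
    show "?f = restr (gsrc A) ?f" by (auto simp: restr_def)
  next
    fix i k r assume "i \<in> {1..gsrc A}" "?f i = Ret k \<or> ?f i = WRet r k"
    then show "k \<in> {1..gtgt A}"
      using play_den_exit_range[OF wf st] f by metis
  next
    fix i j k assume ij: "i \<in> {1..gsrc A}" "j \<in> {1..gsrc A}" "i \<noteq> j \<and> ?f i = Ret k"
    then have "(Inl i, Inl k) \<in> gedg A"
      using play_den_exit(1)[OF wf st ij(1)] f by metis
    \<comment> \<open>The direct edge from entrance \<open>i\<close> uses up the only predecessor of
      exit \<open>k\<close>.\<close>
    then have pred: "s = Inl i" if "(s, Inl k) \<in> gedg A" for s
      using exit_pred_unique[OF wf that] by blast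
    show "?f j \<noteq> Ret k"
      using play_den_exit(1)[OF wf st ij(2), of k] pred ij f by (metis sum.inject(1))
    show "?f j \<noteq> WRet r k" for r
      using play_den_exit(2)[OF wf st ij(2), of r k] pred ij f by (metis sum.distinct(1))
  qed
qed

text \<open>Strategies are total functions on a possibly infinite type; they are finitely many
  because of the default \<open>None\<close> off the finite set \<open>gpos A\<close> and the
  finitely many targets on it.\<close>

lemma finite_strategies:
  assumes "rompg_wf A"
  shows "finite (strategies P A)"
proof -
  let ?N = "{1..gtgt A} <+> gpos A"
  have "strategies P A \<subseteq>
      {\<tau>. \<forall>q. (q \<in> gpos A \<longrightarrow> \<tau> q \<in> insert None (Some ` ?N)) \<and> (q \<notin> gpos A \<longrightarrow> \<tau> q = None)}"
  proof (intro subsetI CollectI allI conjI impI)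
    fix \<tau> q assume \<tau>: "\<tau> \<in> strategies P A"
    show "\<tau> q \<in> insert None (Some ` ?N)"
    proof (cases "\<tau> q")
      case (Some t)
      then have "(Inr q, t) \<in> gedg A" using \<tau> by (simp add: strategies_def)
      then have "t \<in> ?N" using assms by (auto simp: rompg_wf_def)
      with Some show ?thesis by simp
    qed simp
    show "q \<notin> gpos A \<Longrightarrow> \<tau> q = None" using \<tau> unfolding strategies_def by blast
  qed
  moreover have "finite (insert None (Some ` ?N))" "finite (gpos A)"
    using assms by (simp_all add: rompg_wf_def)
  ultimately show ?thesis
    using finite_set_of_finite_funs[of "gpos A" "insert None (Some ` ?N)" None]
    by (simp add: finite_subset)
qed

lemma sr_arrow_W_r: "rompg_wf A \<Longrightarrow> sr_arrow (gsrc A) (gtgt A) (W_r A)"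
  unfolding sr_arrow_def W_r_def Setcompr_eq_image
  by (auto simp: sp_arrow_play_den finite_strategies)

section \<open>Games that reroute exits\<close>

text \<open>Being a strategy is a condition on each position separately, so strategies can be
  transferred and chosen pointwise.\<close>

definition strat_at :: "player \<Rightarrow> 'q rompg \<Rightarrow> 'q \<Rightarrow> (nat + 'q) option \<Rightarrow> bool" where
  "strat_at P A q v \<longleftrightarrow>
     (v \<noteq> None \<longleftrightarrow> q \<in> gpos A \<and> grole A q = P \<and> (\<exists>t. (Inr q, t) \<in> gedg A)) \<and>
     (\<forall>t. v = Some t \<longrightarrow> (Inr q, t) \<in> gedg A)"

lemma strategies_strat_at: "\<tau> \<in> strategies P A \<longleftrightarrow> (\<forall>q. strat_at P A q (\<tau> q))"
  by (simp add: strategies_def strat_at_def)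

text \<open>\<open>h\<close> acts on targets: positions move along \<open>e\<close>, and an exit
  goes to the node of \<open>G\<close> where play continues. Entrances are treated separately in
  each construction.\<close>

definition reroutes :: "(nat + 'a \<Rightarrow> nat + 'b) \<Rightarrow> ('a \<Rightarrow> 'b) \<Rightarrow> 'a rompg \<Rightarrow> 'b rompg \<Rightarrow> bool" where
  "reroutes h e A G \<longleftrightarrow> (\<forall>q. h (Inr q) = Inr (e q) \<and> (e q \<in> gpos G \<longleftrightarrow> q \<in> gpos A) \<and>
     grole G (e q) = grole A q \<and> gwgt G (e q) = gwgt A q \<and>
     (\<forall>t'. (Inr (e q), t') \<in> gedg G \<longleftrightarrow> (\<exists>t. (Inr q, t) \<in> gedg A \<and> h t = t')))"

lemma strat_at_push:
  "reroutes h e A G \<Longrightarrow> strat_at P A q v \<Longrightarrow> strat_at P G (e q) (map_option h v)"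
  unfolding reroutes_def strat_at_def by (cases v) auto

text \<open>Any preimage of the chosen edge will do. There may be several, as two exits can continue
  at the same position, but equality of sets of denotations only takes surjectivity.\<close>

lemma strat_at_pull:
  assumes "reroutes h e A G" "strat_at P G (e q) v'"
  shows "\<exists>v. strat_at P A q v \<and> v' = map_option h v"
proof (cases v')
  case None
  then show ?thesis
    using assms unfolding reroutes_def strat_at_def by (intro exI[of _ None]) auto
next
  case (Some t')
  then obtain t where "(Inr q, t) \<in> gedg A" "h t = t'"
    using assms unfolding reroutes_def strat_at_def by blast
  then show ?thesis
    using assms Some unfolding reroutes_def strat_at_def by (intro exI[of _ "Some t"]) auto
qed

lemma strategies_reroute:
  assumes "reroutes h id A G"
  shows "strategies P G = (\<lambda>\<tau>. map_option h \<circ> \<tau>) ` strategies P A"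
proof (intro equalityI subsetI)
  fix \<tau>' assume "\<tau>' \<in> strategies P G"
  then have "\<forall>q. \<exists>v. strat_at P A q v \<and> \<tau>' q = map_option h v"
    using strat_at_pull[OF assms] by (simp add: strategies_strat_at)
  then obtain \<tau> where "\<forall>q. strat_at P A q (\<tau> q) \<and> \<tau>' q = map_option h (\<tau> q)" by metis
  then show "\<tau>' \<in> (\<lambda>\<tau>. map_option h \<circ> \<tau>) ` strategies P A"
    by (intro image_eqI[of _ _ \<tau>]) (auto simp: strategies_strat_at)
next
  fix \<tau>' assume "\<tau>' \<in> (\<lambda>\<tau>. map_option h \<circ> \<tau>) ` strategies P A"
  then show "\<tau>' \<in> strategies P G"
    using strat_at_push[OF assms] by (auto simp: strategies_strat_at)
qed

definition strat_sum :: "(nat + 'a \<Rightarrow> nat + ('a + 'b)) \<Rightarrow> (nat + 'b \<Rightarrow> nat + ('a + 'b)) \<Rightarrow>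
    ('a \<Rightarrow> (nat + 'a) option) \<Rightarrow> ('b \<Rightarrow> (nat + 'b) option) \<Rightarrow>
    'a + 'b \<Rightarrow> (nat + ('a + 'b)) option" where
  "strat_sum h1 h2 \<tau>1 \<tau>2 = case_sum (map_option h1 \<circ> \<tau>1) (map_option h2 \<circ> \<tau>2)"

lemma strategies_sum:
  assumes "reroutes h1 Inl A G" "reroutes h2 Inr B G"
  shows "\<tau> \<in> strategies P G \<longleftrightarrow>
    (\<exists>\<tau>1\<in>strategies P A. \<exists>\<tau>2\<in>strategies P B. \<tau> = strat_sum h1 h2 \<tau>1 \<tau>2)"
proof
  assume "\<tau> \<in> strategies P G"
  then have "\<forall>q. \<exists>v. strat_at P A q v \<and> \<tau> (Inl q) = map_option h1 v"
      "\<forall>q. \<exists>v. strat_at P B q v \<and> \<tau> (Inr q) = map_option h2 v"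
    using strat_at_pull[OF assms(1)] strat_at_pull[OF assms(2)]
    by (simp_all add: strategies_strat_at)
  then obtain \<tau>1 \<tau>2 where *: "\<forall>q. strat_at P A q (\<tau>1 q) \<and> \<tau> (Inl q) = map_option h1 (\<tau>1 q)"
      "\<forall>q. strat_at P B q (\<tau>2 q) \<and> \<tau> (Inr q) = map_option h2 (\<tau>2 q)" by metis
  then have "\<tau> = strat_sum h1 h2 \<tau>1 \<tau>2"
    by (intro ext) (auto simp: strat_sum_def split: sum.split)
  moreover have "\<tau>1 \<in> strategies P A" "\<tau>2 \<in> strategies P B"
    using * by (auto simp: strategies_strat_at)
  ultimately show "\<exists>\<tau>1\<in>strategies P A. \<exists>\<tau>2\<in>strategies P B. \<tau> = strat_sum h1 h2 \<tau>1 \<tau>2"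
    by blast
next
  assume "\<exists>\<tau>1\<in>strategies P A. \<exists>\<tau>2\<in>strategies P B. \<tau> = strat_sum h1 h2 \<tau>1 \<tau>2"
  then show "\<tau> \<in> strategies P G"
    using strat_at_push[OF assms(1)] strat_at_push[OF assms(2)]
    by (auto simp: strategies_strat_at strat_sum_def split: sum.split)
qed

text \<open>Shared by composition and tensor: strategies on a disjoint union are pairs of
  independent choices, so the sets of sets combine elementwise by the operation \<open>c\<close> on
  single arrows.\<close>

lemma W_r_sum:
  assumes "reroutes h1 Inl A G" "reroutes h2 Inr B G"
    and "\<And>te te2 ta ta2. te \<in> strategies PE A \<Longrightarrow> te2 \<in> strategies PE B \<Longrightarrow>
        ta \<in> strategies PA A \<Longrightarrow> ta2 \<in> strategies PA B \<Longrightarrow>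
        restr (gsrc G) (play_den G (strat_sum h1 h2 te te2) (strat_sum h1 h2 ta ta2))
        = c (restr (gsrc A) (play_den A te ta)) (restr (gsrc B) (play_den B te2 ta2))"
  shows "W_r G = {{c f g | f g. f \<in> F' \<and> g \<in> G'} | F' G'. F' \<in> W_r A \<and> G' \<in> W_r B}"
proof -
  have inner: "{restr (gsrc G) (play_den G (strat_sum h1 h2 te te2) ta) | ta. ta \<in> strategies PA G}
      = {c f g | f g. f \<in> {restr (gsrc A) (play_den A te ta) | ta. ta \<in> strategies PA A} \<and>
                      g \<in> {restr (gsrc B) (play_den B te2 ta) | ta. ta \<in> strategies PA B}}"
    (is "?L te te2 = ?R te te2")
    if st: "te \<in> strategies PE A" "te2 \<in> strategies PE B" for te te2
  proof -
    have "?L te te2 = {restr (gsrc G) (play_den G (strat_sum h1 h2 te te2) (strat_sum h1 h2 ta ta2)) | ta ta2.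
        ta \<in> strategies PA A \<and> ta2 \<in> strategies PA B}"
      unfolding strategies_sum[OF assms(1,2), of _ PA] by blast
    also have "\<dots> = {c (restr (gsrc A) (play_den A te ta)) (restr (gsrc B) (play_den B te2 ta2)) | ta ta2.
        ta \<in> strategies PA A \<and> ta2 \<in> strategies PA B}"
      by (simp add: assms(3)[OF st] cong: rev_conj_cong)
    also have "\<dots> = ?R te te2" by auto
    finally show ?thesis .
  qed
  have "W_r G = {?L te te2 | te te2. te \<in> strategies PE A \<and> te2 \<in> strategies PE B}"
    unfolding W_r_def strategies_sum[OF assms(1,2), of _ PE] by blast
  also have "\<dots> = {?R te te2 | te te2. te \<in> strategies PE A \<and> te2 \<in> strategies PE B}"
    by (simp only: inner cong: rev_conj_cong)
  also have "\<dots> = {{c f g | f g. f \<in> F' \<and> g \<in> G'} | F' G'. F' \<in> W_r A \<and> G' \<in> W_r B}"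
    unfolding W_r_def by blast
  finally show ?thesis .
qed

lemma den_strat_sum:
  fixes te ta :: "'a \<Rightarrow> (nat + 'a) option" and te2 ta2 :: "'b \<Rightarrow> (nat + 'b) option"
  assumes "reroutes h1 Inl A G" "reroutes h2 Inr B G"
  defines "te' \<equiv> strat_sum h1 h2 te te2" and "ta' \<equiv> strat_sum h1 h2 ta ta2"
  shows "den G te' ta' (h1 x) = tbind (den A te ta x) (\<lambda>k. den G te' ta' (h1 (Inl k)))"
    and "den G te' ta' (h2 y) = tbind (den B te2 ta2 y) (\<lambda>k. den G te' ta' (h2 (Inl k)))"
  using assms
  by (intro den_bind[where e = Inl] den_bind[where e = Inr]; simp add: reroutes_def strat_sum_def)+

section \<open>Composition, tensor and constants\<close>

lemma tbind_Ret [simp]: "tbind v Ret = v"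
  by (cases v) auto

lemma W_r_rcomp:
  fixes A :: "'a rompg" and B :: "'b rompg"
  assumes A: "rompg_wf A" and B: "rompg_wf B" and AB: "gtgt A = gsrc B"
  shows "W_r (rcomp A B) = Scomp (gsrc A) (W_r A) (W_r B)"
proof -
  \<comment> \<open>Exit \<open>i\<close> of \<open>A\<close> is fused with entrance
    \<open>i\<close> of \<open>B\<close>, so play goes on at the unique successor of that
    entrance.\<close>
  define h1 :: "nat + 'a \<Rightarrow> nat + ('a + 'b)" where
    "h1 x = (case x of Inl i \<Rightarrow> map_sum id Inr (esucc B i) | Inr q \<Rightarrow> Inr (Inl q))" for x
  define h2 :: "nat + 'b \<Rightarrow> nat + ('a + 'b)" where "h2 = map_sum id Inr"
  let ?G = "rcomp A B"
  have ms: "map_sum id Inl s \<noteq> (Inr (Inr q') :: nat + ('a + 'b))" for s q'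
    by (cases s) simp_all
  have edge: "(map_sum id Inl s, t') \<in> gedg ?G \<longleftrightarrow> (\<exists>t. (s, t) \<in> gedg A \<and> h1 t = t')" for s t'
  proof -
    have inj: "map_sum id Inl s = (map_sum id Inl s' :: nat + ('a + 'b)) \<longleftrightarrow> s = s'" for s s' :: "nat + 'a"
      by (cases s; cases s') auto
    have "(map_sum id Inl s, t') \<in> gedg ?G \<longleftrightarrow> (\<exists>q. (s, Inr q) \<in> gedg A \<and> Inr (Inl q) = t') \<or>
        (\<exists>i t. i \<in> {1..gtgt A} \<and> (s, Inl i) \<in> gedg A \<and> (Inl i, t) \<in> gedg B \<and> map_sum id Inr t = t')"
      using ms by (fastforce simp: rcomp_def inj)
    \<comment> \<open>Well-formedness puts \<open>i\<close> in range, and \<open>esucc B i\<close>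
      is then the only target of entrance \<open>i\<close>.\<close>
    also have "\<dots> \<longleftrightarrow> (\<exists>q. (s, Inr q) \<in> gedg A \<and> Inr (Inl q) = t') \<or>
        (\<exists>i. (s, Inl i) \<in> gedg A \<and> map_sum id Inr (esucc B i) = t')"
      using esucc_edge[OF B] gedg_nodes(3)[OF A, of s] AB by auto
    also have "\<dots> \<longleftrightarrow> (\<exists>t. (s, t) \<in> gedg A \<and> h1 t = t')"
      by (auto simp: h1_def split_sum_ex)
    finally show ?thesis .
  qed
  have r1: "reroutes h1 Inl A ?G"
    unfolding reroutes_def
  proof (intro allI conjI)
    fix q t'
    show "((Inr (Inl q), t') \<in> gedg ?G) = (\<exists>t. (Inr q, t) \<in> gedg A \<and> h1 t = t')"
      using edge[of "Inr q" t'] by simp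
  qed (auto simp: h1_def rcomp_def)
  have r2: "reroutes h2 Inr B ?G"
    unfolding reroutes_def
  proof (intro allI conjI)
    fix q t'
    show "((Inr (Inr q), t') \<in> gedg ?G) = (\<exists>t. (Inr q, t) \<in> gedg B \<and> h2 t = t')"
      by (auto simp: rcomp_def h2_def ms[symmetric])
  qed (auto simp: h2_def rcomp_def)
  have "restr (gsrc ?G) (play_den ?G (strat_sum h1 h2 te te2) (strat_sum h1 h2 ta ta2))
      = spcomp (gsrc A) (restr (gsrc A) (play_den A te ta)) (restr (gsrc B) (play_den B te2 ta2))"
    if st: "te \<in> strategies PE A" "te2 \<in> strategies PE B"
      "ta \<in> strategies PA A" "ta2 \<in> strategies PA B" for te te2 ta ta2
  proof -
    let ?d = "den ?G (strat_sum h1 h2 te te2) (strat_sum h1 h2 ta ta2)"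
    have "?d (esucc ?G i) = tbind (play_den A te ta i) (restr (gsrc B) (play_den B te2 ta2))"
      if i: "i \<in> {1..gsrc A}" for i
    proof -
      have "(Inl i, t') \<in> gedg ?G \<longleftrightarrow> t' = h1 (esucc A i)" for t'
        using edge[of "Inl i" t'] esucc_edge[OF A i] by auto
      then have "esucc ?G i = h1 (esucc A i)" unfolding esucc_def[of ?G] by simp
      \<comment> \<open>The continuation at exit \<open>k\<close> is
        \<open>h1 (Inl k) = h2 (esucc B k)\<close>, which is a play of \<open>B\<close>.\<close>
      then have "?d (esucc ?G i) = tbind (play_den A te ta i) (\<lambda>k. ?d (h2 (esucc B k)))"
        using den_strat_sum(1)[OF r1 r2, of te te2 ta ta2 "esucc A i"]
        by (simp add: play_den_eq_den h1_def h2_def)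
      also have "(\<lambda>k. ?d (h2 (esucc B k))) = play_den B te2 ta2"
      proof
        have "h2 (Inl k') = Inl k'" for k' by (simp add: h2_def)
        then show "?d (h2 (esucc B k)) = play_den B te2 ta2 k" for k
          using den_strat_sum(2)[OF r1 r2, of te te2 ta ta2 "esucc B k"]
          by (simp add: play_den_eq_den)
      qed
      \<comment> \<open>Restricting changes nothing here, since every exit reached in
        \<open>A\<close> is an entrance of \<open>B\<close>.\<close>
      also have "tbind (play_den A te ta i) (play_den B te2 ta2)
          = tbind (play_den A te ta i) (restr (gsrc B) (play_den B te2 ta2))"
        using play_den_exit_range[OF A st(1,3) i] AB
        by (cases "play_den A te ta i") (auto simp: restr_def)
      finally show ?thesis .
    qed
    moreover have "gsrc ?G = gsrc A" by (simp add: rcomp_def)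
    ultimately show ?thesis
      by (auto simp: spcomp_eq_tbind restr_def fun_eq_iff play_den_eq_den[of ?G])
  qed
  then show ?thesis
    unfolding Scomp_def by (rule W_r_sum[OF r1 r2])
qed

lemma W_r_rtensor:
  fixes C :: "'c rompg" and D :: "'d rompg"
  assumes C: "rompg_wf C" and D: "rompg_wf D"
  shows "W_r (rtensor C D) = Stensor (gsrc C) (gtgt C) (gsrc D) (W_r C) (W_r D)"
proof -
  define h1 :: "nat + 'c \<Rightarrow> nat + ('c + 'd)" where "h1 = map_sum id Inl"
  \<comment> \<open>Targets shift by \<open>gtgt C\<close>, whereas sources in \<open>edge\<close>
    shift by \<open>gsrc C\<close>.\<close>
  define h2 :: "nat + 'd \<Rightarrow> nat + ('c + 'd)" where "h2 = shift_node (gtgt C)"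
  let ?G = "rtensor C D"
  have edge: "(s', t') \<in> gedg ?G \<longleftrightarrow> (\<exists>s t. (s, t) \<in> gedg C \<and> s' = map_sum id Inl s \<and> h1 t = t') \<or>
      (\<exists>s t. (s, t) \<in> gedg D \<and> s' = shift_node (gsrc C) s \<and> h2 t = t')" for s' t'
    unfolding rtensor_def h1_def h2_def by auto
  have ms: "(Inr (Inl q) :: nat + ('c + 'd)) = map_sum id Inl s \<longleftrightarrow> s = Inr q"
      "(Inr (Inr q') :: nat + ('c + 'd)) \<noteq> map_sum id Inl s"
      "(Inl i :: nat + ('c + 'd)) = map_sum id Inl s \<longleftrightarrow> s = Inl i"
      "(Inr (Inl q) :: nat + ('c + 'd)) \<noteq> shift_node (gsrc C) s'"
      "(Inr (Inr q') :: nat + ('c + 'd)) = shift_node (gsrc C) s' \<longleftrightarrow> s' = Inr q'"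
      "(Inl i :: nat + ('c + 'd)) = shift_node (gsrc C) s' \<longleftrightarrow> (\<exists>j. s' = Inl j \<and> i = gsrc C + j)"
    for s s' q q' i
    by (cases s; cases s'; force simp: shift_node_def)+
  have r1: "reroutes h1 Inl C ?G"
    unfolding reroutes_def edge by (auto simp: ms h1_def) (auto simp: rtensor_def)
  have r2: "reroutes h2 Inr D ?G"
    unfolding reroutes_def edge by (auto simp: ms) (auto simp: h2_def rtensor_def shift_node_def)
  have "restr (gsrc ?G) (play_den ?G (strat_sum h1 h2 te te2) (strat_sum h1 h2 ta ta2))
      = sptensor (gsrc C) (gtgt C) (gsrc D)
          (restr (gsrc C) (play_den C te ta)) (restr (gsrc D) (play_den D te2 ta2))"
    for te te2 ta ta2
  proof -
    let ?d = "den ?G (strat_sum h1 h2 te te2) (strat_sum h1 h2 ta ta2)"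
    have "?d (esucc ?G i) = play_den C te ta i" if i: "i \<in> {1..gsrc C}" for i
    proof -
      have "(Inl i, t') \<in> gedg ?G \<longleftrightarrow> t' = h1 (esucc C i)" for t'
        unfolding edge ms using esucc_edge[OF C i] gedg_nodes(1)[OF D] i by fastforce
      then have "esucc ?G i = h1 (esucc C i)" unfolding esucc_def[of ?G] by simp
      then show ?thesis
        using den_strat_sum(1)[OF r1 r2, of te te2 ta ta2 "esucc C i"]
        by (simp add: play_den_eq_den) (simp add: h1_def)
    qed
    moreover have "?d (esucc ?G i) = tshift (gtgt C) (play_den D te2 ta2 (i - gsrc C))"
      if "\<not> i \<le> gsrc C" "i \<le> gsrc C + gsrc D" for i
    proof -
      have i: "i - gsrc C \<in> {1..gsrc D}" using that by auto
      have "(Inl i, t') \<in> gedg ?G \<longleftrightarrow> t' = h2 (esucc D (i - gsrc C))" for t'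
        unfolding edge ms using esucc_edge[OF D i] gedg_nodes(1)[OF C, of i] that
        by (force simp: Nat.le_imp_diff_is_add)
      then have "esucc ?G i = h2 (esucc D (i - gsrc C))" unfolding esucc_def[of ?G] by simp
      \<comment> \<open>The image of an exit is again an exit, so the continuation only
        renumbers.\<close>
      moreover have "tbind v (\<lambda>k. Ret (d + k)) = tshift d v" for v d by (cases v) auto
      ultimately show ?thesis
        using den_strat_sum(2)[OF r1 r2, of te te2 ta ta2 "esucc D (i - gsrc C)"]
        by (simp add: play_den_eq_den) (simp add: h2_def shift_node_def)
    qed
    moreover have "gsrc ?G = gsrc C + gsrc D" by (simp add: rtensor_def)
    ultimately show ?thesis
      by (auto simp: sptensor_def restr_def fun_eq_iff play_den_eq_den[of ?G])
  qed
  then show ?thesis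
    unfolding Stensor_def by (intro W_r_sum[OF r1 r2])
qed

text \<open>Without positions each player has exactly one strategy, the empty one.\<close>

lemma W_r_no_positions:
  assumes "gpos A = {}" "\<And>i. i \<in> {1..gsrc A} \<Longrightarrow> esucc A i = Inl (f i)"
  shows "W_r A = {{restr (gsrc A) (\<lambda>i. Ret (f i))}}"
proof -
  have "strategies P A = {\<lambda>_. None}" for P
    using assms(1) by (auto simp: strategies_def)
  moreover have "restr (gsrc A) (play_den A te ta) = restr (gsrc A) (\<lambda>i. Ret (f i))" for te ta
    using assms(2) by (auto simp: restr_def play_den_eq_den)
  ultimately show ?thesis by (simp add: W_r_def)
qed

lemma W_r_rid: "W_r (rid m) = Sid m"
  using W_r_no_positions[of "rid m" "\<lambda>i. i"]
  by (simp add: rid_def Sid_def spid_def esucc_def)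

lemma W_r_rsym: "W_r (rsym m n :: 'a rompg) = Ssym m n"
proof -
  let ?G = "rsym m n :: 'a rompg"
  define f where "f i = (if i \<le> m then n + i else i - m)" for i
  have g: "gsrc ?G = m + n" and p: "gpos ?G = {}" by (simp_all add: rsym_def)
  have "esucc ?G i = Inl (f i)" if "i \<in> {1..m + n}" for i
    unfolding esucc_def using that
    by (intro the_equality) (auto simp: rsym_def f_def intro: exI[of _ "i - m"])
  then have "W_r ?G = {{restr (m + n) (\<lambda>i. Ret (f i))}}"
    using W_r_no_positions[OF p, unfolded g] by simp
  then show ?thesis
    by (simp add: Ssym_def spsym_def f_def if_distrib)
qed


section \<open>Mean payoff over segments\<close>

lemma sum_lessThan_add: "(\<Sum>i<a + b. f i) = (\<Sum>i<a. f i) + (\<Sum>i<b. f (a + i))"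
  for f :: "nat \<Rightarrow> real"
  by (induction b) (simp_all add: add.assoc)

text \<open>Zero terms off \<open>I\<close> make a partial sum depend only on how many elements of
  \<open>I\<close> lie below \<open>J\<close>, so enumeration can be replaced by counting.\<close>

lemma mp_enumerate:
  fixes v :: "nat \<Rightarrow> real"
  assumes inf: "infinite I" and zero: "\<And>j. j \<notin> I \<Longrightarrow> v j = 0"
  shows "mp (\<lambda>t. v (enumerate I t)) \<longleftrightarrow>
    (\<forall>\<epsilon>>0. \<exists>C. \<forall>J. (\<Sum>j<J. v j) \<ge> - \<epsilon> * real (card {j\<in>I. j < J}) - C)"
proof -
  have inj: "inj_on (enumerate I) {..<N}" for N
    using strict_mono_enumerate[OF inf] by (meson inj_on_subset strict_mono_imp_inj_on subset_UNIV)
  have sum: "(\<Sum>j<J. v j) = (\<Sum>t<N. v (enumerate I t)) \<and> card {j\<in>I. j < J} = N"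
    if "{j\<in>I. j < J} = enumerate I ` {..<N}" for J N
  proof -
    have "(\<Sum>j<J. v j) = (\<Sum>j\<in>{j\<in>I. j < J}. v j)"
      using zero by (intro sum.mono_neutral_right) auto
    also have "\<dots> = (\<Sum>t<N. v (enumerate I t))"
      unfolding that by (simp add: sum.reindex[OF inj])
    finally show ?thesis using that inj by (simp add: card_image)
  qed
  have le: "enumerate I s < enumerate I t \<longleftrightarrow> s < t" for s t
    using strict_mono_less[OF strict_mono_enumerate[OF inf]] .
  have at: "{j\<in>I. j < enumerate I N} = enumerate I ` {..<N}" for N
  proof (intro equalityI subsetI)
    fix j assume j: "j \<in> {j\<in>I. j < enumerate I N}"
    then obtain t where "j = enumerate I t" using enumerate_Ex[of I j] inf by auto
    with j show "j \<in> enumerate I ` {..<N}" using le by auto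
  next
    fix j assume "j \<in> enumerate I ` {..<N}"
    then show "j \<in> {j\<in>I. j < enumerate I N}"
      using enumerate_in_set[OF inf] le by auto
  qed
  have ex: "\<exists>N. {j\<in>I. j < J} = enumerate I ` {..<N}" for J
  proof -
    \<comment> \<open>The number of elements of \<open>I\<close> below \<open>J\<close>.\<close>
    define N where "N = (LEAST N. enumerate I N \<ge> J)"
    have "enumerate I N \<ge> J"
      unfolding N_def using le_enumerate[OF inf] by (rule LeastI)
    have lt: "enumerate I t < J" if "t < N" for t
      using not_less_Least[OF that[unfolded N_def]] by simp
    have "j < J \<longleftrightarrow> j < enumerate I N" if "j \<in> I" for j
    proof -
      obtain t where t: "j = enumerate I t" using enumerate_Ex[of I j] inf \<open>j \<in> I\<close> by auto
      show ?thesis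
      proof
        assume "j < J"
        then show "j < enumerate I N" using \<open>enumerate I N \<ge> J\<close> by simp
      next
        assume "j < enumerate I N"
        then have "t < N" using le t by simp
        then show "j < J" using lt t by simp
      qed
    qed
    then have "{j\<in>I. j < J} = {j\<in>I. j < enumerate I N}" by (intro Collect_cong conj_cong refl)
    with at[of N] show ?thesis by (intro exI[of _ N]) (simp only:)
  qed
  have "(\<forall>N. (\<Sum>t<N. v (enumerate I t)) \<ge> - \<epsilon> * real N - C)
      \<longleftrightarrow> (\<forall>J. (\<Sum>j<J. v j) \<ge> - \<epsilon> * real (card {j\<in>I. j < J}) - C)" for \<epsilon> C :: real
  proof (intro iffI allI)
    fix J
    assume *: "\<forall>N. (\<Sum>t<N. v (enumerate I t)) \<ge> - \<epsilon> * real N - C"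
    obtain N where "{j\<in>I. j < J} = enumerate I ` {..<N}" using ex by blast
    then show "(\<Sum>j<J. v j) \<ge> - \<epsilon> * real (card {j\<in>I. j < J}) - C"
      using * sum by simp
  next
    fix N
    assume "\<forall>J. (\<Sum>j<J. v j) \<ge> - \<epsilon> * real (card {j\<in>I. j < J}) - C"
    then show "(\<Sum>t<N. v (enumerate I t)) \<ge> - \<epsilon> * real N - C"
      using sum[OF at[of N]] by metis
  qed
  then show ?thesis unfolding mp_iff by (simp only:)
qed

text \<open>\<open>w\<close> is cut into consecutive segments with totals \<open>v J\<close>.
  Segments may be empty, as when a play crosses the loop without meeting a position.\<close>

locale segments =
  fixes w v :: "nat \<Rightarrow> real" and len :: "nat \<Rightarrow> nat" and L :: nat
  assumes len_le: "len J \<le> L"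
    and inf: "infinite {J. 0 < len J}"
    and seg: "(\<Sum>i<len J. w ((\<Sum>j<J. len j) + i)) = v J"
begin

abbreviation start :: "nat \<Rightarrow> nat" where "start J \<equiv> \<Sum>j<J. len j"

lemma start_mono: "J \<le> J' \<Longrightarrow> start J \<le> start J'"
  by (rule sum_mono2) auto

lemma start_unbounded: "\<exists>J. N < start J"
proof (induction N)
  case 0
  obtain J where "0 < len J" using inf not_finite_existsD by auto
  then show ?case by (intro exI[of _ "Suc J"]) simp
next
  case (Suc N)
  then obtain J where J: "N < start J" by blast
  obtain J' where "J' > J" "0 < len J'"
    using inf unfolding infinite_nat_iff_unbounded by auto
  then show ?case
    using J start_mono[of J J'] by (intro exI[of _ "Suc J'"]) simp
qed

lemma sum_start: "(\<Sum>i<start J. w i) = (\<Sum>j<J. v j)"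
  by (induction J) (simp_all add: sum_lessThan_add seg)

text \<open>Each nonempty segment contributes between \<open>1\<close> and \<open>L\<close>
  steps.\<close>

lemma start_bounds:
  defines "c J \<equiv> card {j\<in>{J. 0 < len J}. j < J}"
  shows "c J \<le> start J" "start J \<le> L * c J"
proof -
  have "{j\<in>{J. 0 < len J}. j < Suc J} =
      (if 0 < len J then insert J {j\<in>{J. 0 < len J}. j < J} else {j\<in>{J. 0 < len J}. j < J})" for J
    by (auto simp: less_Suc_eq)
  then have c_Suc: "c (Suc J) = c J + (if 0 < len J then 1 else 0)" for J
    unfolding c_def by simp
  have c0: "c 0 = 0" by (simp add: c_def)
  show "c J \<le> start J"
    by (induction J) (auto simp: c_Suc c0)
  show "start J \<le> L * c J"
    by (induction J) (use len_le in \<open>auto simp: c_Suc c0 add_mono add.commute\<close>)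
qed

text \<open>Forward, sums are compared at segment boundaries. Backward, \<open>N\<close> is compared
  with the start of its segment; the unfinished part costs at most \<open>L * B\<close>.\<close>

lemma mp_segments:
  fixes B :: real
  assumes bnd: "\<And>i. \<bar>w i\<bar> \<le> B"
  shows "mp w \<longleftrightarrow> mp (\<lambda>t. v (enumerate {J. 0 < len J} t))"
proof -
  let ?c = "\<lambda>J. card {j\<in>{J. 0 < len J}. j < J}"
  have zero: "v j = 0" if "j \<notin> {J. 0 < len J}" for j
    using seg[of j] that by simp
  have enum: "mp (\<lambda>t. v (enumerate {J. 0 < len J} t)) \<longleftrightarrow>
      (\<forall>\<epsilon>>0. \<exists>C. \<forall>J. (\<Sum>j<J. v j) \<ge> - \<epsilon> * real (?c J) - C)"
    by (rule mp_enumerate[OF inf zero])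
  show ?thesis
  proof
    assume w: "mp w"
    show "mp (\<lambda>t. v (enumerate {J. 0 < len J} t))"
      unfolding enum
    proof (intro allI impI)
      fix \<epsilon> :: real assume "\<epsilon> > 0"
      \<comment> \<open>At most \<open>L\<close> steps are charged to each nonempty segment; the
        \<open>+ 1\<close> keeps the divisor positive without a case on \<open>L\<close>.\<close>
      then have "\<epsilon> / (real L + 1) > 0" by simp
      with w obtain C where C: "\<And>N. (\<Sum>i<N. w i) \<ge> - (\<epsilon> / (real L + 1)) * real N - C"
        unfolding mp_iff by blast
      have "(\<Sum>j<J. v j) \<ge> - \<epsilon> * real (?c J) - C" for J
      proof -
        have "real (start J) \<le> real (L * ?c J)"
          using start_bounds(2)[of J] by (simp only: of_nat_le_iff)
        also have "\<dots> \<le> (real L + 1) * real (?c J)" by (simp add: algebra_simps)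
        finally have "(\<epsilon> / (real L + 1)) * real (start J)
            \<le> (\<epsilon> / (real L + 1)) * ((real L + 1) * real (?c J))"
          using \<open>\<epsilon> > 0\<close> by (intro mult_left_mono) auto
        also have "\<dots> = \<epsilon> * real (?c J)" by (simp add: add_nonneg_eq_0_iff)
        finally show ?thesis using C[of "start J"] by (simp add: sum_start)
      qed
      then show "\<exists>C. \<forall>J. (\<Sum>j<J. v j) \<ge> - \<epsilon> * real (?c J) - C" by blast
    qed
  next
    assume v: "mp (\<lambda>t. v (enumerate {J. 0 < len J} t))"
    show "mp w"
      unfolding mp_iff
    proof (intro allI impI)
      fix \<epsilon> :: real assume "\<epsilon> > 0"
      with v obtain C where C: "\<And>J. (\<Sum>j<J. v j) \<ge> - \<epsilon> * real (?c J) - C"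
        unfolding enum by blast
      have "(\<Sum>i<N. w i) \<ge> - \<epsilon> * real N - (C + real L * B)" for N
      proof -
        \<comment> \<open>\<open>Suc J'\<close> is the first segment starting after
          \<open>N\<close>, so \<open>N\<close> falls into segment \<open>J'\<close>; the least
          index is not \<open>0\<close> because \<open>start 0 = 0\<close>.\<close>
        obtain J' where J': "(LEAST J. N < start J) = Suc J'"
          using LeastI_ex[OF start_unbounded, of N] by (cases "LEAST J. N < start J") auto
        have "N < start (Suc J')"
          using LeastI_ex[OF start_unbounded, of N] J' by simp
        moreover have le: "start J' \<le> N"
          using not_less_Least[of J' "\<lambda>J. N < start J"] J' by simp
        ultimately obtain k where k: "N = start J' + k" "k < len J'"
          by (metis add_less_cancel_left le_Suc_ex sum.lessThan_Suc)
        have "\<bar>\<Sum>i<k. w (start J' + i)\<bar> \<le> (\<Sum>i<k. B)"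
          using bnd by (intro order_trans[OF sum_abs] sum_mono) auto
        also have "\<dots> \<le> real L * B"
          using k(2) len_le[of J'] bnd[of 0] by (auto intro!: mult_right_mono)
        finally have "(\<Sum>i<N. w i) \<ge> (\<Sum>j<J'. v j) - real L * B"
          unfolding k(1) by (simp add: sum_lessThan_add sum_start)
        moreover have "\<epsilon> * real (?c J') \<le> \<epsilon> * real N"
          using start_bounds(1)[of J'] le \<open>\<epsilon> > 0\<close> by (intro mult_left_mono) auto
        ultimately show ?thesis using C[of J'] by simp
      qed
      then show "\<exists>C. \<forall>N. (\<Sum>i<N. w i) \<ge> - \<epsilon> * real N - C" by blast
    qed
  qed
qed

end

section \<open>Trace\<close>

text \<open>\<open>trace_val\<close> with an arbitrary current value as its start, for the same
  reason as \<open>den\<close>.\<close>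

definition tloop :: "nat \<Rightarrow> (nat \<Rightarrow> tval) \<Rightarrow> tval \<Rightarrow> tval" where
  "tloop l f v =
    (let s = run (tnext l f) v in
     if \<exists>j. s j = None then
       (let K = (LEAST j. s j = None);
            S = (\<Sum>j<K. tweight (the (s j)));
            hasw = (\<exists>j<K. is_weighted (the (s j)))
        in case the (s (K - 1)) of
             EW \<Rightarrow> EW | AW \<Rightarrow> AW
           | Ret k \<Rightarrow> (if hasw then WRet S (k - l) else Ret (k - l))
           | WRet r k \<Rightarrow> WRet S (k - l))
     else
       (let I = {j. is_weighted (the (s j))}
        in if mp (\<lambda>t. tweight (the (s (enumerate I t)))) then EW else AW))"

lemma vseq_eq_run: "vseq l f i = run (tnext l f) (f (l + i))"
proof
  show "vseq l f i j = run (tnext l f) (f (l + i)) j" for j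
    by (induction j) auto
qed

lemma trace_val_eq_tloop: "trace_val l f i = tloop l f (f (l + i))"
  unfolding trace_val_def tloop_def vseq_eq_run mp_def Let_def by (rule refl)

lemma tloop_stop:
  assumes "tnext l f v = None"
  shows "tloop l f v = tbind v (\<lambda>k. Ret (k - l))"
proof -
  have "(LEAST j. run (tnext l f) v j = None) = 1"
    by (rule Least_equality) (use assms in \<open>auto simp: Suc_le_eq intro: gr0I\<close>)
  moreover have "\<exists>j. run (tnext l f) v j = None"
    using assms by (intro exI[of _ 1]) simp
  ultimately show ?thesis
    by (cases v) (simp_all add: tloop_def Let_def)
qed

text \<open>The counterpart of \<open>den_step\<close> for terminating sequences; infinite ones are
  compared as a whole in \<open>denT_infinite\<close>.\<close>

lemma tloop_step:
  assumes nx: "tnext l f v = Some v'" and j: "run (tnext l f) v' j = None"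
  shows "tloop l f v = tbind v (\<lambda>_. tloop l f v')"
proof -
  let ?r = "run (tnext l f)"
  have sh: "?r v (Suc i) = ?r v' i" for i
    by (simp only: run_Suc_shift nx) simp
  obtain i where i: "(LEAST j. ?r v' j = None) = Suc i" "?r v' i \<noteq> None"
    using Least_run_None_pos[OF j] .
  have L: "(LEAST j. ?r v j = None) = Suc (Suc i)"
    using Least_run_None[of "tnext l f", OF nx j] i by simp
  have ex: "\<exists>j. ?r v j = None" "\<exists>j. ?r v' j = None" using j sh by metis+
  define S where "S = (\<Sum>j<Suc i. tweight (the (?r v' j)))"
  define H where "H \<longleftrightarrow> (\<exists>j<Suc i. is_weighted (the (?r v' j)))"
  have S: "(\<Sum>j<Suc (Suc i). tweight (the (?r v j))) = tweight v + S"
    unfolding S_def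
    by (subst sum.lessThan_Suc_shift) (simp add: sh del: sum.lessThan_Suc run.simps(2))
  have H: "(\<exists>j<Suc (Suc i). is_weighted (the (?r v j))) \<longleftrightarrow> is_weighted v \<or> H"
    unfolding H_def by (subst Ex_less_Suc2) (simp add: sh del: run.simps(2))
  \<comment> \<open>Matters when a weighted \<open>v\<close> is followed only by unweighted values:
    the definition yields \<open>tweight v + S\<close>, but \<open>addw\<close> yields
    \<open>tweight v\<close>.\<close>
  have unweighted: "S = 0" if "\<not> H"
    unfolding S_def
  proof (rule sum.neutral, intro ballI)
    fix j assume "j \<in> {..<Suc i}"
    with that show "tweight (the (?r v' j)) = 0"
      unfolding H_def by (cases "the (?r v' j)") auto
  qed
  have "tloop l f v = (case the (?r v' i) of EW \<Rightarrow> EW | AW \<Rightarrow> AW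
      | Ret k \<Rightarrow> (if is_weighted v \<or> H then WRet (tweight v + S) (k - l) else Ret (k - l))
      | WRet r k \<Rightarrow> WRet (tweight v + S) (k - l))"
    unfolding tloop_def Let_def L diff_Suc_1 S H sh if_P[OF ex(1)] ..
  moreover have "tloop l f v' = (case the (?r v' i) of EW \<Rightarrow> EW | AW \<Rightarrow> AW
      | Ret k \<Rightarrow> (if H then WRet S (k - l) else Ret (k - l))
      | WRet r k \<Rightarrow> WRet S (k - l))"
    unfolding tloop_def Let_def i(1) diff_Suc_1 S_def[symmetric] H_def[symmetric] if_P[OF ex(2)] ..
  ultimately show ?thesis
    using nx unweighted by (cases v; cases "the (?r v' i)") (auto simp del: run.simps)
qed


text \<open>\<open>resolves l E x y\<close>: following loop edges from the target node \<open>x\<close> of \<open>E\<close> ends in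
  the target node \<open>y\<close> of the trace, whose exits are numbered from \<open>1\<close> again.\<close>

inductive resolves :: "nat \<Rightarrow> 'q rompg \<Rightarrow> nat + 'q \<Rightarrow> nat + 'q \<Rightarrow> bool" for l E where
  pos: "resolves l E (Inr q) (Inr q)"
| exit: "l < k \<Longrightarrow> resolves l E (Inl k) (Inl (k - l))"
| loop: "i \<in> {1..l} \<Longrightarrow> (Inl i, t) \<in> gedg E \<Longrightarrow> resolves l E t y \<Longrightarrow> resolves l E (Inl i) y"

text \<open>Arbitrary on exits that lie on or lead into a cycle of loop edges.\<close>

definition emb :: "nat \<Rightarrow> 'q rompg \<Rightarrow> nat + 'q \<Rightarrow> nat + 'q" where
  "emb l E x = (THE y. resolves l E x y)"

lemma resolves_Inr [simp]: "resolves l E (Inr q) y \<longleftrightarrow> y = Inr q"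
  by (auto intro: resolves.pos elim: resolves.cases)

lemma resolves_exit [simp]: "l < k \<Longrightarrow> resolves l E (Inl k) y \<longleftrightarrow> y = Inl (k - l)"
  by (auto intro: resolves.exit elim: resolves.cases)

lemma emb_Inr [simp]: "emb l E (Inr q) = Inr q"
  by (simp add: emb_def)

lemma emb_exit: "l < k \<Longrightarrow> emb l E (Inl k) = Inl (k - l)"
  by (simp add: emb_def)

section \<open>Edges and strategies of the trace\<close>

locale trace_game =
  fixes E :: "'q rompg" and l m n :: nat
  assumes wf: "rompg_wf E" and src: "gsrc E = l + m" and tgt: "gtgt E = l + n"
begin

abbreviation "T \<equiv> rtrace l m n E"
abbreviation "res \<equiv> resolves l E"
abbreviation "em \<equiv> emb l E"

lemma rtrace_sel [simp]:
  "gpos T = gpos E" "gsrc T = m" "gtgt T = n" "grole T = grole E" "gwgt T = gwgt E"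
  by (simp_all add: rtrace_def)

lemma edge_src: "i \<in> {1..l + m} \<Longrightarrow> (Inl i, t) \<in> gedg E \<longleftrightarrow> t = esucc E i"
  using esucc_edge[OF wf] src by simp

lemma res_loop: "i \<in> {1..l} \<Longrightarrow> res (Inl i) y \<longleftrightarrow> res (esucc E i) y"
  using edge_src[of i "esucc E i"] edge_src[of i]
  by (auto intro: resolves.loop elim: resolves.cases)

lemma em_loop: "i \<in> {1..l} \<Longrightarrow> em (Inl i) = em (esucc E i)"
  by (simp add: emb_def res_loop)

lemma res_det: "res x y \<Longrightarrow> res x z \<Longrightarrow> y = z"
proof (induction arbitrary: z rule: resolves.induct)
  case (loop i t y)
  then show ?case using res_loop[of i z] edge_src[of i t] by auto
qed auto

lemma res_em: "res x y \<Longrightarrow> em x = y"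
  unfolding emb_def using res_det by blast

text \<open>An exit that does not resolve would lie on a cycle of unweighted loop edges; by uniqueness of
  predecessors such a cycle cannot be entered from outside.\<close>

lemma res_total:
  assumes "(s, t) \<in> gedg E" "s \<notin> Inl ` {1..l}"
  shows "\<exists>y. res t y"
proof (rule ccontr)
  assume t: "\<nexists>y. res t y"
  define S where "S = {i\<in>{1..l}. \<nexists>y. res (Inl i) y}"
  have bad: "\<exists>i\<in>S. x = Inl i" if "(s, x) \<in> gedg E" "\<nexists>y. res x y" for s x
  proof (cases x)
    case (Inl i)
    then have "\<not> l < i" "1 \<le> i"
      using that gedg_nodes(3)[OF wf, of s i] by auto
    then show ?thesis using that Inl by (auto simp: S_def)
  qed (use that in auto)
  have "\<exists>j. i \<in> S \<longrightarrow> (Inl i, Inl j) \<in> gedg E \<and> j \<in> S" for i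
  proof (cases "i \<in> S")
    case True
    then have "(Inl i, esucc E i) \<in> gedg E" "\<nexists>y. res (esucc E i) y"
      using edge_src[of i] res_loop[of i] by (auto simp: S_def)
    with bad show ?thesis by metis
  qed simp
  then obtain g where g: "\<And>i. i \<in> S \<Longrightarrow> (Inl i, Inl (g i)) \<in> gedg E \<and> g i \<in> S" by metis
  \<comment> \<open>Uniqueness of predecessors makes \<open>g\<close> injective; on the finite set
    \<open>S\<close> it is then onto, so \<open>i\<close> already has its only predecessor inside
    the loop.\<close>
  have "inj_on g S"
    using exit_pred_unique[OF wf] g by (intro inj_onI) (metis sum.inject(1))
  moreover have "finite S" "g ` S \<subseteq> S" using g by (auto simp: S_def)
  ultimately have "g ` S = S" by (simp add: endo_inj_surj)
  moreover obtain i where i: "i \<in> S" "t = Inl i" using bad[OF assms(1) t] by blast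
  ultimately obtain j where "j \<in> S" "i = g j" by blast
  then have "s = Inl j" using exit_pred_unique[OF wf assms(1)[unfolded i(2)]] g by blast
  with \<open>j \<in> S\<close> assms(2) show False by (auto simp: S_def)
qed

lemma res_em_iff: "(s, t) \<in> gedg E \<Longrightarrow> s \<notin> Inl ` {1..l} \<Longrightarrow> res t y \<longleftrightarrow> em t = y"
  using res_total res_em by blast

abbreviation "loops \<equiv> {(a, b). a \<in> {1..l} \<and> b \<in> {1..l} \<and> (Inl a, Inl b) \<in> gedg E}"

text \<open>\<open>s\<close> is arbitrary so that the induction hypothesis applies to the loop
  entrance \<open>Inl i\<close>; one edge is then put in front of the path.\<close>

lemma res_path:
  assumes "res t y" "(s, t) \<in> gedg E"
  shows "y \<in> {1..n} <+> gpos E \<and> ((s, hat_node l y) \<in> gedg E \<or>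
    (\<exists>i j. i \<in> {1..l} \<and> j \<in> {1..l} \<and> (s, Inl i) \<in> gedg E \<and> (i, j) \<in> loops\<^sup>* \<and>
      (Inl j, hat_node l y) \<in> gedg E))"
  using assms
proof (induction arbitrary: s rule: resolves.induct)
  case (pos q)
  then show ?case using gedg_nodes(4)[OF wf] by (auto simp: hat_node_def)
next
  case (exit k)
  then have "k \<in> {1..l + n}" using gedg_nodes(3)[OF wf, of s k] tgt by simp
  with exit show ?case by (auto simp: hat_node_def)
next
  case (loop i t y)
  from loop.IH[OF loop.hyps(2)] show ?case
  proof (elim conjE disjE exE)
    assume "y \<in> {1..n} <+> gpos E" "(Inl i, hat_node l y) \<in> gedg E"
    with loop show ?thesis by blast
  next
    fix i' j assume *: "y \<in> {1..n} <+> gpos E" "i' \<in> {1..l}" "j \<in> {1..l}" "(Inl i, Inl i') \<in> gedg E"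
      "(i', j) \<in> loops\<^sup>*" "(Inl j, hat_node l y) \<in> gedg E"
    then have "(i, j) \<in> loops\<^sup>*"
      using loop.hyps(1) by (intro converse_rtrancl_into_rtrancl[of i i']) auto
    with * loop show ?thesis by blast
  qed
qed

lemma path_res:
  assumes "(i, j) \<in> loops\<^sup>*" "i \<in> {1..l}" "(Inl j, t) \<in> gedg E" "res t y"
  shows "res (Inl i) y"
  using assms
proof (induction rule: converse_rtrancl_induct)
  case (step i k)
  then show ?case using resolves.loop[of i l "Inl k" E y] by auto
qed (rule resolves.loop)

text \<open>A source of the trace is never a loop entrance in \<open>E\<close>, so
  \<open>res_total\<close> resolves every edge out of it and the function \<open>em\<close> can
  replace the relation.\<close>

lemma rtrace_edge:
  assumes s: "s \<in> {1..m} <+> gpos E"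
  shows "(s, y) \<in> gedg T \<longleftrightarrow> (\<exists>t. (hat_node l s, t) \<in> gedg E \<and> em t = y)"
proof -
  have out: "hat_node l s \<notin> Inl ` {1..l}"
    using s by (auto simp: hat_node_def)
  have hat: "res (hat_node l y) y" if "y \<in> {1..n} <+> gpos E"
    using that by (auto simp: hat_node_def)
  have "(s, y) \<in> gedg T \<longleftrightarrow> (\<exists>t. (hat_node l s, t) \<in> gedg E \<and> res t y)"
  proof
    assume "(s, y) \<in> gedg T"
    then have "y \<in> {1..n} <+> gpos E" and "(hat_node l s, hat_node l y) \<in> gedg E \<or>
      (\<exists>i j. i \<in> {1..l} \<and> j \<in> {1..l} \<and> (hat_node l s, Inl i) \<in> gedg E \<and> (i, j) \<in> loops\<^sup>* \<and>
        (Inl j, hat_node l y) \<in> gedg E)"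
      by (simp_all add: rtrace_def)
    with hat path_res show "\<exists>t. (hat_node l s, t) \<in> gedg E \<and> res t y" by blast
  next
    assume "\<exists>t. (hat_node l s, t) \<in> gedg E \<and> res t y"
    with res_path s show "(s, y) \<in> gedg T" by (simp add: rtrace_def) blast
  qed
  also have "\<dots> \<longleftrightarrow> (\<exists>t. (hat_node l s, t) \<in> gedg E \<and> em t = y)"
    using res_em_iff[OF _ out] by blast
  finally show ?thesis .
qed

lemma reroutes_em: "reroutes em id E T"
  unfolding reroutes_def
proof (intro allI conjI)
  fix q t'
  show "((Inr (id q), t') \<in> gedg T) = (\<exists>t. (Inr q, t) \<in> gedg E \<and> em t = t')"
  proof (cases "q \<in> gpos E")
    case True
    then show ?thesis using rtrace_edge[of "Inr q" t'] by (auto simp: hat_node_def)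
  next
    case False
    then show ?thesis using gedg_nodes(2)[OF wf] by (auto simp: rtrace_def)
  qed
qed simp_all

lemma esucc_rtrace:
  assumes "i \<in> {1..m}"
  shows "esucc T i = em (esucc E (l + i))"
proof -
  have "(Inl i, y) \<in> gedg T \<longleftrightarrow> y = em (esucc E (l + i))" for y
    using rtrace_edge[OF InlI[OF assms], of y] edge_src[of "l + i"] assms
    by (auto simp: hat_node_def)
  then show ?thesis unfolding esucc_def[of T] by simp
qed

end

section \<open>Plays of the trace under a fixed pair of strategies\<close>

locale trace_play = trace_game E l m n for E :: "'q rompg" and l m n +
  fixes te ta :: "'q \<Rightarrow> (nat + 'q) option"
  assumes te: "te \<in> strategies PE E" and ta: "ta \<in> strategies PA E"
begin

abbreviation "stepE \<equiv> next_node E te ta"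
abbreviation "teT \<equiv> \<lambda>q. map_option em (te q)"
abbreviation "taT \<equiv> \<lambda>q. map_option em (ta q)"
abbreviation "stepT \<equiv> next_node T teT taT"
abbreviation "denE \<equiv> den E te ta"
abbreviation "denT \<equiv> den T teT taT"
abbreviation "f \<equiv> restr (gsrc E) (play_den E te ta)"

lemma stepT: "stepT (Inr q) = map_option em (stepE (Inr q))"
  by simp

text \<open>Unlike in a composition, the continuation is again a play of the trace, so this unfolds
  the loop once.\<close>

lemma denT_em: "denT (em x) = tbind (denE x) (\<lambda>k. denT (em (Inl k)))"
  by (rule den_bind[where e = id]) simp_all

lemma runT: "run stepE x j = Some y \<Longrightarrow> run stepT (em x) j = Some (em y)"
proof (induction j arbitrary: y)
  case (Suc j)
  then obtain z where z: "run stepE x j = Some z" "stepE z = Some y"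
    by (cases "run stepE x j") auto
  then obtain q where "z = Inr q" by (cases z) auto
  then show ?case using z Suc.IH[OF z(1)] stepT[of q] by (simp del: next_node.simps)
qed simp

lemma f_loop: "k \<in> {1..l} \<Longrightarrow> f k = denE (esucc E k)"
  by (simp add: restr_def play_den_eq_den src)

lemma strategies_T: "teT \<in> strategies PE T" "taT \<in> strategies PA T"
  using strategies_reroute[OF reroutes_em] te ta by (auto simp: comp_def)

lemma exit_range:
  assumes "(s, x) \<in> gedg E" "denE x = Ret k \<or> denE x = WRet r k"
  shows "k \<in> {1..l + n}"
  using assms den_Ret_imp[of E te ta x k] den_WRet_edge[OF te ta, of x r k] gedg_nodes(3)[OF wf]
    tgt by auto

text \<open>\<open>denT_em\<close> and \<open>tloop_step\<close> unfold both sides by the same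
  recursion. The edge into \<open>x\<close> confines exits to \<open>{1..l + n}\<close>, so an exit
  index outside \<open>{1..l}\<close> exceeds \<open>l\<close>.\<close>

lemma denT_finite:
  assumes "run (tnext l f) (denE x) j = None" "(s, x) \<in> gedg E"
  shows "denT (em x) = tloop l f (denE x)"
  using assms
proof (induction "denE x" arbitrary: s x rule: run_finite_induct)
  case stop
  have "denT (em (Inl k)) = Ret (k - l)" if "denE x = Ret k \<or> denE x = WRet r k" for r k
  proof -
    have "k \<in> {1..l + n}" using exit_range stop.prems that by blast
    moreover have "k \<notin> {1..l}" using stop.hyps that by auto
    ultimately show ?thesis by (simp add: emb_exit)
  qed
  then show ?case
    using tloop_stop[OF stop.hyps] denT_em[of x] by (cases "denE x") auto
next
  case (step v' j)
  obtain r k where k: "denE x = Ret k \<or> denE x = WRet r k" "k \<in> {1..l}" "v' = f k"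
    using step.hyps(1) by (cases "denE x") (auto split: if_splits)
  then have v': "v' = denE (esucc E k)" using f_loop by simp
  have "(Inl k, esucc E k) \<in> gedg E" using edge_src[of k] k(2) by simp
  then have "denT (em (Inl k)) = tloop l f v'"
    using step.hyps(3)[OF v'] v' em_loop[OF k(2)] by simp
  then show ?case
    using tloop_step[OF step.hyps(1,2)] denT_em[of x] k(1) by auto
qed


text \<open>Recovers from a denotation the stretch of play behind it: its length \<open>p\<close>,
  its total weight and its final exit.\<close>

lemma segment:
  assumes "denE x \<notin> {EW, AW}"
  shows "\<exists>p k. run stepE x p = Some (Inl k) \<and> (\<Sum>i<p. node_wgt E (the (run stepE x i))) = tweight (denE x)
    \<and> (0 < p \<longleftrightarrow> is_weighted (denE x)) \<and> (denE x = Ret k \<or> (\<exists>r. denE x = WRet r k))"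
proof -
  from assms obtain j where "run stepE x j = None"
    using den_infinite[of E te ta x] by fastforce
  then show ?thesis
    using assms
  proof (induction rule: run_finite_induct)
    case (stop x)
    then obtain k where "x = Inl k" by (cases x) (auto simp: den_stop split: if_splits)
    then show ?case by (intro exI[of _ 0] exI[of _ k]) simp
  next
    case (step x y j)
    then obtain q where x: "x = Inr q" by (cases x) auto
    have d: "denE x = addw (gwgt E q) (denE y)" using den_step step.hyps x by simp
    then have "denE y \<notin> {EW, AW}" using step.prems by auto
    then obtain p k where p: "run stepE y p = Some (Inl k)"
        "(\<Sum>i<p. node_wgt E (the (run stepE y i))) = tweight (denE y)"
        "denE y = Ret k \<or> (\<exists>r. denE y = WRet r k)"
      using step.IH by blast
    have sh: "run stepE x (Suc i) = run stepE y i" for i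
      by (simp only: run_Suc_shift step.hyps(1)) simp
    have "(\<Sum>i<Suc p. node_wgt E (the (run stepE x i))) = gwgt E q + tweight (denE y)"
      by (subst sum.lessThan_Suc_shift) (simp only: sh p(2), simp add: x)
    with p sh d show ?case
      by (intro exI[of _ "Suc p"] exI[of _ k]) (auto simp del: sum.lessThan_Suc run.simps(2))
  qed
qed

text \<open>The loop is never left, so the play of the trace is cut at the visits to the loop and
  \<open>mp_segments\<close> compares the averages.\<close>

lemma denT_infinite:
  assumes inf: "\<And>j. run (tnext l f) (denE x) j \<noteq> None"
    and edge: "(s, x) \<in> gedg E" "s \<notin> Inl ` {1..l}"
  shows "denT (em x) = tloop l f (denE x)"
proof -
  obtain len target where
    seg: "\<And>x. denE x \<notin> {EW, AW} \<Longrightarrow> run stepE x (len x) = Some (Inl (target x)) \<and>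
      (\<Sum>i<len x. node_wgt E (the (run stepE x i))) = tweight (denE x) \<and>
      (0 < len x \<longleftrightarrow> is_weighted (denE x)) \<and>
      (denE x = Ret (target x) \<or> (\<exists>r. denE x = WRet r (target x)))"
    using segment by metis
  define xs where "xs = rec_nat x (\<lambda>_ y. esucc E (target y))"
  have xs_0 [simp]: "xs 0 = x" and xs_Suc [simp]: "xs (Suc J) = esucc E (target (xs J))" for J
    by (simp_all add: xs_def)
  have tnext_target: "denE y \<notin> {EW, AW} \<and> target y \<in> {1..l} \<and> v = f (target y)"
    if "tnext l f (denE y) = Some v" for y v
    using that seg[of y] by (cases "denE y") (auto split: if_splits)
  have loop: "run (tnext l f) (denE x) J = Some (denE (xs J))" for J
  proof (induction J)
    case (Suc J)
    then obtain v where "tnext l f (denE (xs J)) = Some v"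
      using inf[of "Suc J"] by auto
    then show ?case using Suc tnext_target[of "xs J" v] f_loop by auto
  qed simp
  have next_J: "denE (xs J) \<notin> {EW, AW}" "target (xs J) \<in> {1..l}" for J
  proof -
    obtain v where "tnext l f (denE (xs J)) = Some v"
      using inf[of "Suc J"] loop[of J] by auto
    from tnext_target[OF this] show "denE (xs J) \<notin> {EW, AW}" "target (xs J) \<in> {1..l}" by auto
  qed
  note seg_J = seg[OF next_J(1)]
  \<comment> \<open>An empty segment passes resolution on along a loop edge; a weighted one ends
    with an edge from a position, to which \<open>res_total\<close> applies.\<close>
  have res_J: "\<exists>y. res (xs J) y" for J
  proof (induction J)
    case 0
    show ?case using res_total[OF edge] by simp
  next
    case (Suc J)
    have "\<exists>y. res (Inl (target (xs J))) y"
    proof (cases "denE (xs J)")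
      case (Ret k)
      then show ?thesis using Suc.IH seg_J[of J] den_Ret_imp[OF Ret] by auto
    next
      case (WRet r k)
      then obtain q where "(Inr q, Inl (target (xs J))) \<in> gedg E"
        using seg_J[of J] den_WRet_edge[OF te ta WRet] by auto
      then show ?thesis using res_total by blast
    qed (use next_J(1)[of J] in auto)
    then show ?case using res_loop[OF next_J(2)] by simp
  qed
  \<comment> \<open>While segments are empty, \<open>xs\<close> runs through a chain of loop edges.
    It ends at a position, where a weighted segment starts, since an exit above \<open>l\<close>
    would stop the sequence.\<close>
  have weighted: "\<exists>J'\<ge>J. is_weighted (denE (xs J'))" if "res z y" "xs J = z" for z y J
    using that
  proof (induction arbitrary: J rule: resolves.induct)
    case (pos q)
    then show ?case
      using den_Ret_imp[of E te ta "Inr q"] next_J(1)[of J] by (intro exI[of _ J]) (cases "denE (xs J)"; auto)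
  next
    case (exit k)
    then show ?case using seg_J[of J] next_J(2)[of J] by auto
  next
    case (loop i t y)
    have "target (xs J) = i" using seg_J[of J] loop.prems by auto
    then have "xs (Suc J) = t" using loop.hyps(1,2) edge_src[of i t] by simp
    from loop.IH[OF this] show ?case by (meson Suc_leD)
  qed
  define w where "w i = node_wgt T (the (run stepT (em x) i))" for i
  define v where "v J = tweight (denE (xs J))" for J
  \<comment> \<open>Every segment starts at \<open>x\<close> or at the successor of a loop entrance,
    so only finitely many lengths occur.\<close>
  define L where "L = Max (len ` insert x (esucc E ` {1..l}))"
  let ?len = "\<lambda>J. len (xs J)"
  have em_next: "em (Inl (target (xs J))) = em (xs (Suc J))" for J
    using em_loop[OF next_J(2)] by simp
  \<comment> \<open>The segments concatenate because \<open>em\<close> identifies the exit ending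
    one segment with the start of the next.\<close>
  have start: "run stepT (em x) (\<Sum>j<J. ?len j) = Some (em (xs J))" for J
  proof (induction J)
    case (Suc J)
    have "run stepT (em (xs J)) (?len J) = Some (em (xs (Suc J)))"
      using runT seg_J[of J] em_next[of J] by metis
    with Suc show ?case by (simp add: run_add)
  qed simp
  interpret segments w v ?len L
  proof
    fix J
    have "xs J \<in> insert x (esucc E ` {1..l})" using next_J(2) by (cases J) auto
    then show "?len J \<le> L" unfolding L_def by (intro Max_ge) auto
    have "w ((\<Sum>j<J. ?len j) + i) = node_wgt E (the (run stepE (xs J) i))" if "i < ?len J" for i
    proof -
      have "run stepE (xs J) (Suc i) \<noteq> None"
        using that seg_J[of J] run_None_mono[of stepE "xs J" "Suc i" "?len J"] by auto
      then obtain z where z: "run stepE (xs J) i = Some z" and "stepE z \<noteq> None"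
        by (cases "run stepE (xs J) i") auto
      then have "node_wgt T (em z) = node_wgt E z" by (cases z) auto
      then show ?thesis unfolding w_def run_add start using z runT[OF z] by simp
    qed
    then show "(\<Sum>i<?len J. w ((\<Sum>j<J. ?len j) + i)) = v J"
      using seg_J[of J] by (simp add: v_def)
  next
    show "infinite {J. 0 < ?len J}"
      unfolding infinite_nat_iff_unbounded_le using weighted res_J seg_J by (metis mem_Collect_eq)
  qed
  have runT_inf: "run stepT (em x) N \<noteq> None" for N
    using start_unbounded[of N] start run_None_mono[of stepT "em x" N] by (metis less_imp_le option.distinct(1))
  \<comment> \<open>An infinite play stays on the finitely many positions, which bounds its
    weights.\<close>
  have "\<bar>w i\<bar> \<le> (\<Sum>q\<in>gpos E. \<bar>gwgt E q\<bar>)" for i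
  proof -
    obtain z where z: "run stepT (em x) i = Some z" using runT_inf by blast
    obtain z' where "stepT z = Some z'" using runT_inf[of "Suc i"] z by auto
    then obtain q where q: "z = Inr q" "q \<in> gpos E"
      using next_node_edge[OF strategies_T] by (metis rtrace_sel(1))
    moreover have "finite (gpos E)" using wf by (simp add: rompg_wf_def)
    ultimately show ?thesis
      using z by (simp add: w_def member_le_sum[of q _ "\<lambda>q. \<bar>gwgt E q\<bar>"])
  qed
  then have "mp w \<longleftrightarrow> mp (\<lambda>t. v (enumerate {J. 0 < ?len J} t))" by (rule mp_segments)
  moreover have "denT (em x) = (if mp w then EW else AW)"
    unfolding w_def by (rule den_infinite) (rule runT_inf)
  \<comment> \<open>Nonempty segments are exactly the weighted values, so both sides enumerate the
    same index set.\<close>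
  moreover have "tloop l f (denE x) = (if mp (\<lambda>t. v (enumerate {J. 0 < ?len J} t)) then EW else AW)"
    unfolding tloop_def Let_def loop v_def using seg_J by simp
  ultimately show ?thesis by simp
qed

lemma restr_play_den_rtrace: "restr m (play_den T teT taT) = sptrace l m f"
proof
  fix i
  show "restr m (play_den T teT taT) i = sptrace l m f i"
  proof (cases "i \<in> {1..m}")
    case True
    then have li: "l + i \<in> {1..l + m}" by auto
    have edge: "(Inl (l + i), esucc E (l + i)) \<in> gedg E" using edge_src[OF li] by simp
    have "Inl (l + i) \<notin> Inl ` {1..l}" using True by auto
    then have "denT (em (esucc E (l + i))) = tloop l f (denE (esucc E (l + i)))"
      using denT_finite[OF _ edge] denT_infinite[OF _ edge] by blast
    moreover have "f (l + i) = denE (esucc E (l + i))"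
      using li by (simp add: restr_def play_den_eq_den src)
    ultimately show ?thesis
      using True esucc_rtrace[OF True]
      by (simp add: restr_def sptrace_def trace_val_eq_tloop play_den_eq_den[of T])
  next
    case False
    then show ?thesis unfolding sptrace_def by (simp only: restr_def if_False)
  qed
qed

end

text \<open>By \<open>strategies_reroute\<close> both strategy sets of the trace are images of those
  of \<open>E\<close>, so the equation for single denotations passes to the sets of sets.\<close>

lemma W_r_rtrace:
  assumes "rompg_wf E" "gsrc E = l + m" "gtgt E = l + n"
  shows "W_r (rtrace l m n E) = Strace l m (W_r E)"
proof -
  interpret trace_game E l m n by unfold_locales fact+
  let ?W = "\<lambda>te ta. restr (gsrc E) (play_den E te ta)"
  have eq: "restr m (play_den T (map_option em \<circ> te) (map_option em \<circ> ta)) = sptrace l m (?W te ta)"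
    if "te \<in> strategies PE E" "ta \<in> strategies PA E" for te ta
  proof -
    interpret trace_play E l m n te ta by unfold_locales fact+
    show ?thesis using restr_play_den_rtrace by (simp add: comp_def)
  qed
  have "W_r T = (\<lambda>te. (\<lambda>ta. restr m (play_den T (map_option em \<circ> te) (map_option em \<circ> ta)))
      ` strategies PA E) ` strategies PE E"
    unfolding W_r_def Setcompr_eq_image strategies_reroute[OF reroutes_em] by (simp add: image_image)
  also have "\<dots> = (\<lambda>te. (\<lambda>ta. sptrace l m (?W te ta)) ` strategies PA E) ` strategies PE E"
    by (intro image_cong refl) (rule eq)
  also have "\<dots> = Strace l m (W_r E)"
    unfolding W_r_def Strace_def Setcompr_eq_image by (simp add: image_image)
  finally show ?thesis .
qed

theorem theorem4p11:
  fixes A :: "'a rompg" and B :: "'b rompg"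
    and C :: "'c rompg" and D :: "'d rompg"
    and E :: "'e rompg" and l m n :: nat
  shows
    "(rompg_wf A \<longrightarrow> sr_arrow (gsrc A) (gtgt A) (W_r A))
   \<and> (rompg_wf A \<and> rompg_wf B \<and> gtgt A = gsrc B \<longrightarrow>
        W_r (rcomp A B) = Scomp (gsrc A) (W_r A) (W_r B))
   \<and> (rompg_wf C \<and> rompg_wf D \<longrightarrow>
        W_r (rtensor C D) = Stensor (gsrc C) (gtgt C) (gsrc D) (W_r C) (W_r D))
   \<and> (rompg_wf E \<and> gsrc E = l + m \<and> gtgt E = l + n \<longrightarrow>
        W_r (rtrace l m n E) = Strace l m (W_r E))
   \<and> W_r (rid m :: 'a rompg) = Sid m
   \<and> W_r (rsym m n :: 'a rompg) = Ssym m n"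
  by (simp add: sr_arrow_W_r W_r_rcomp W_r_rtensor W_r_rtrace W_r_rid W_r_rsym)

end
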